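(* Let $\mathcal{A}\in\mathbb{C}^{n_1\times n_1\times n_3}$ and $\mathrm{Ind}(\mathcal{A})=k$. Suppose $\mathcal{A}^k$ has the C-QDR decomposition $\mathcal{A}^k=\mathcal{Q}*_c\mathcal{D}*_c\mathcal{R}$. Then $$\mathcal{A}^D=\mathcal{Q}*_c(\mathcal{R}*_c\mathcal{A}*_c\mathcal{Q})^{-1}*_c\mathcal{R}.$$
   Context: For a third-order tensor $\mathcal{A}\in\mathbb{C}^{n_1\times n_2\times n_3}$, $\mathcal{A}^{(i)}=\mathcal{A}(:,:,i)\in\mathbb{C}^{n_1\times n_2}$ denotes its $i$-th frontal slice. Let $\mathbf{C}_{n_3}$ be the $n_3\times n_3$ orthogonal DCT matrix, with entries $(\mathbf{C}_{n_3})_{jk}=\sqrt{(2-\delta_{j1})/n_3}\,\cos\big(\tfrac{(j-1)(2k-1)\pi}{2n_3}\big)$; let $\mathbf{W}$ be the diagonal matrix whose diagonal is the first column of $\mathbf{C}_{n_3}$; let $\mathbf{Z}$ be the $n_3\times n_3$ matrix with ones on the first superdiagonal and zeros elsewhere; and put $\mathbf{M}=\mathbf{W}^{-1}\mathbf{C}_{n_3}(\mathbf{I}+\mathbf{Z})$, an invertible matrix. Define the linear bijection $L$ on tensors with third dimension $n_3$ by $L(\mathcal{A})_{ijk}=\sum_{l=1}^{n_3}\mathbf{M}_{kl}\mathcal{A}_{ijl}$. The C-product of $\mathcal{A}\in\mathbb{C}^{n_1\times n_2\times n_3}$ and $\mathcal{B}\in\mathbb{C}^{n_2\times l\times n_3}$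 is the tensor $\mathcal{A}*_c\mathcal{B}\in\mathbb{C}^{n_1\times l\times n_3}$ determined by $L(\mathcal{A}*_c\mathcal{B})^{(i)}=L(\mathcal{A})^{(i)}L(\mathcal{B})^{(i)}$, $i=1,\dots,n_3$. The identity tensor $\mathcal{I}\in\mathbb{C}^{n\times n\times n_3}$ is determined by $L(\mathcal{I})^{(i)}=\mathbf{I}_n$ for all $i$. Powers are with respect to $*_c$, with $\mathcal{A}^0=\mathcal{I}$. The inverse $\mathcal{B}^{-1}$ of $\mathcal{B}\in\mathbb{C}^{n\times n\times n_3}$ is the tensor with $\mathcal{B}*_c\mathcal{B}^{-1}=\mathcal{B}^{-1}*_c\mathcal{B}=\mathcal{I}$; a formula containing an inverse includes the assertion that the inverse exists. A tensor is F-diagonal (F-upper) if all its frontal slices are diagonal (upper triangular) matrices. A C-QDR decomposition of $\mathcal{B}\in\mathbb{C}^{m_1\times m_2\times n_3}$ is a factorization $\mathcal{B}=\mathcal{Q}*_c\mathcal{D}*_c\mathcal{R}$, for some $r$, where $\mathcal{Q}\in\mathbb{C}^{m_1\times r\times n_3}$ with each $L(\mathcal{Q})^{(i)}\in\mathbb{C}^{m_1\times r}$ of rank $r$, $\mathcal{D}\in\mathbb{C}^{r\times r\times n_3}$ is an invertible F-diagonal tensor, and $\mathcal{R}\in\mathbb{C}^{r\times m_2\times n_3}$ is an F-upper tensor with each $L(\mathcal{R})^{(i)}\in\mathbb{C}^{r\times m_2}$ of rank $r$, $i=1,\dots,n_3$. $\mathrm{mat}(\mathcal{A})$ is the $n_3\times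 n_3$ block Toeplitz-plus-Hankel matrix whose $(p,q)$ block is $\mathcal{A}^{(|p-q|+1)}+\mathbf{H}_{pq}$, where $\mathbf{H}_{pq}=\mathcal{A}^{(p+q)}$ if $p+q\le n_3$, $\mathbf{H}_{pq}=O$ if $p+q=n_3+1$, and $\mathbf{H}_{pq}=\mathcal{A}^{(2n_3+2-p-q)}$ if $p+q\ge n_3+2$. The index $\mathrm{Ind}(A)$ of a square matrix $A$ is the smallest nonnegative integer $k$ with $\mathrm{rank}(A^k)=\mathrm{rank}(A^{k+1})$, and $\mathrm{Ind}(\mathcal{A})=\mathrm{Ind}(\mathrm{mat}(\mathcal{A}))$. If $\mathrm{Ind}(\mathcal{A})=k$, the Drazin inverse $\mathcal{A}^D$ is the (unique) tensor $\mathcal{X}\in\mathbb{C}^{n_1\times n_1\times n_3}$ with $\mathcal{A}^{k+1}*_c\mathcal{X}=\mathcal{A}^k$, $\mathcal{X}*_c\mathcal{A}*_c\mathcal{X}=\mathcal{X}$, $\mathcal{A}*_c\mathcal{X}=\mathcal{X}*_c\mathcal{A}$. *)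

theory Defs
  imports
    Complex_Main
    "Jordan_Normal_Form.Gauss_Jordan_Elimination"
    "Jordan_Normal_Form.DL_Rank"
begin

text \<open>
  A third-order tensor is the list of its frontal slices; the third dimension is the length of the
  list. All indices are 0-based: \<open>A ! k\<close> is the slice written $A^{(k+1)}$ in 1-based notation.
\<close>

type_synonym tensor = "complex mat list"

definition tensors :: "nat \<Rightarrow> nat \<Rightarrow> nat \<Rightarrow> tensor set" where
  "tensors n1 n2 n3 = {A. length A = n3 \<and> set A \<subseteq> carrier_mat n1 n2}"

text \<open>The first two dimensions of a tensor, meaningful when the third one is positive.\<close>

definition trows :: "tensor \<Rightarrow> nat" where
  "trows A = dim_row (hd A)"

definition tcols :: "tensor \<Rightarrow> nat" where
  "tcols A = dim_col (hd A)"

definition dct_mat :: "nat \<Rightarrow> complex mat" where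
  "dct_mat n = mat n n (\<lambda>(j, k). complex_of_real
     (sqrt ((2 - (if j = 0 then 1 else 0)) / real n) *
      cos (real j * (2 * real k + 1) * pi / (2 * real n))))"

definition W_mat :: "nat \<Rightarrow> complex mat" where
  "W_mat n = mat n n (\<lambda>(i, j). if i = j then dct_mat n $$ (i, 0) else 0)"

definition Z_mat :: "nat \<Rightarrow> complex mat" where
  "Z_mat n = mat n n (\<lambda>(i, j). if j = i + 1 then 1 else 0)"

definition M_mat :: "nat \<Rightarrow> complex mat" where
  "M_mat n = the (mat_inverse (W_mat n)) * dct_mat n * (1\<^sub>m n + Z_mat n)"

definition L_trans :: "tensor \<Rightarrow> tensor" where
  "L_trans A = map (\<lambda>k. mat (trows A) (tcols A)
     (\<lambda>(i, j). \<Sum>l<length A. M_mat (length A) $$ (k, l) * A ! l $$ (i, j))) [0..<length A]"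

definition cprod :: "tensor \<Rightarrow> tensor \<Rightarrow> tensor" (infixl \<open>*\<^sub>c\<close> 70) where
  "A *\<^sub>c B = (THE C. C \<in> tensors (trows A) (tcols B) (length A) \<and>
     (\<forall>i<length A. L_trans C ! i = L_trans A ! i * L_trans B ! i))"

definition tident :: "nat \<Rightarrow> nat \<Rightarrow> tensor" where
  "tident n n3 = (THE E. E \<in> tensors n n n3 \<and> (\<forall>i<n3. L_trans E ! i = 1\<^sub>m n))"

primrec tpow :: "tensor \<Rightarrow> nat \<Rightarrow> tensor" where
  "tpow A 0 = tident (trows A) (length A)"
| "tpow A (Suc k) = tpow A k *\<^sub>c A"

definition is_tinverse :: "nat \<Rightarrow> nat \<Rightarrow> tensor \<Rightarrow> tensor \<Rightarrow> bool" where
  "is_tinverse n n3 B X \<longleftrightarrow> B \<in> tensors n n n3 \<and> X \<in> tensors n n n3 \<and>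
     B *\<^sub>c X = tident n n3 \<and> X *\<^sub>c B = tident n n3"

definition tinvertible :: "nat \<Rightarrow> nat \<Rightarrow> tensor \<Rightarrow> bool" where
  "tinvertible n n3 B \<longleftrightarrow> (\<exists>X. is_tinverse n n3 B X)"

definition tinverse :: "tensor \<Rightarrow> tensor" where
  "tinverse B = (THE X. is_tinverse (trows B) (length B) B X)"

definition F_diagonal :: "tensor \<Rightarrow> bool" where
  "F_diagonal A \<longleftrightarrow> (\<forall>S\<in>set A. diagonal_mat S)"

text \<open>
  The constant \<open>upper_triangular\<close> looks at entries outside a matrix with more rows than columns,
  hence the explicit bound on the column index for possibly rectangular slices.
\<close>

definition F_upper :: "tensor \<Rightarrow> bool" where
  "F_upper A \<longleftrightarrow> (\<forall>S\<in>set A. \<forall>i<dim_row S. \<forall>j<dim_col S. j < i \<longrightarrow> S $$ (i, j) = 0)"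

definition mrank :: "complex mat \<Rightarrow> nat" where
  "mrank A = vec_space.rank (dim_row A) A"

definition is_CQDR ::
  "nat \<Rightarrow> nat \<Rightarrow> nat \<Rightarrow> nat \<Rightarrow> tensor \<Rightarrow> tensor \<Rightarrow> tensor \<Rightarrow> tensor \<Rightarrow> bool" where
  "is_CQDR m1 m2 n3 r B Q D R \<longleftrightarrow>
     B \<in> tensors m1 m2 n3 \<and>
     Q \<in> tensors m1 r n3 \<and> (\<forall>i<n3. mrank (L_trans Q ! i) = r) \<and>
     D \<in> tensors r r n3 \<and> tinvertible r n3 D \<and> F_diagonal D \<and>
     R \<in> tensors r m2 n3 \<and> F_upper R \<and> (\<forall>i<n3. mrank (L_trans R ! i) = r) \<and>
     B = Q *\<^sub>c D *\<^sub>c R"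

text \<open>
  Hankel part and blocks of the block Toeplitz-plus-Hankel matrix. With 1-based block positions
  $p' = p + 1$ and $q' = q + 1$, the case distinction is $p' + q' \le n_3$, $p' + q' = n_3 + 1$,
  $p' + q' \ge n_3 + 2$, with slices number $p' + q'$ and $2 n_3 + 2 - p' - q'$ in the outer cases.
\<close>

definition hankel_block :: "tensor \<Rightarrow> nat \<Rightarrow> nat \<Rightarrow> complex mat" where
  "hankel_block A p q = (let n3 = length A in
     if p + q + 1 < n3 then A ! (p + q + 1)
     else if p + q + 1 = n3 then 0\<^sub>m (trows A) (tcols A)
     else A ! (2 * n3 - 1 - p - q))"

definition th_block :: "tensor \<Rightarrow> nat \<Rightarrow> nat \<Rightarrow> complex mat" where
  "th_block A p q = A ! nat \<bar>int p - int q\<bar> + hankel_block A p q"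

definition tmat :: "tensor \<Rightarrow> complex mat" where
  "tmat A = (let m = trows A; n = tcols A; n3 = length A in
     mat (m * n3) (n * n3) (\<lambda>(a, b). th_block A (a div m) (b div n) $$ (a mod m, b mod n)))"

definition mindex :: "complex mat \<Rightarrow> nat" where
  "mindex A = (LEAST k. mrank (A ^\<^sub>m k) = mrank (A ^\<^sub>m (k + 1)))"

definition tindex :: "tensor \<Rightarrow> nat" where
  "tindex A = mindex (tmat A)"

definition is_drazin_inverse :: "tensor \<Rightarrow> tensor \<Rightarrow> bool" where
  "is_drazin_inverse A X \<longleftrightarrow>
     X \<in> tensors (trows A) (trows A) (length A) \<and>
     tpow A (tindex A + 1) *\<^sub>c X = tpow A (tindex A) \<and>
     X *\<^sub>c A *\<^sub>c X = X \<and>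
     A *\<^sub>c X = X *\<^sub>c A"

definition drazin_inverse :: "tensor \<Rightarrow> tensor" where
  "drazin_inverse A = (THE X. is_drazin_inverse A X)"

end

theory Submission
  imports Defs
begin

text \<open>
  The linear map \<open>L\<close> turns the C-product into independent products of matrix slices and is bijective,
  since the transform matrix is invertible (\<open>det_M_mat\<close>). So equations between tensors may be checked
  slice by slice, and tensors may be constructed by prescribing their slices (\<open>cprod_slices\<close>,
  \<open>tensor_eq_of_slices\<close>, \<open>ex1_tensor_slices\<close>).

  Only the index is not defined slicewise, but by the Toeplitz-plus-Hankel matrix \<open>T = mat(A)\<close>. For
  each \<open>i\<close>, the cosine wave \<open>p \<mapsto> cos ((2 * p + 1) * i * \<pi> / (2 * n\<^sub>3))\<close>, blown up to a block row
  \<open>V\<^sub>i\<close>, satisfies \<open>V\<^sub>i * T = a\<^sub>i * V\<^sub>i\<close> with the slice \<open>a\<^sub>i\<close> of \<open>L(A)\<close>, and \<open>V\<^sub>i\<close> has a right inverse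
  (\<open>cos_block_row_tmat\<close>, \<open>cos_block_row_right_inverse\<close>). If \<open>k\<close> is the index of \<open>T\<close>, then
  \<open>T ^ k = T ^ (k + 1) * Y\<close> for some \<open>Y\<close> by equality of ranks, and hence
  \<open>a\<^sub>i ^ k = a\<^sub>i ^ (k + 1) * y\<^sub>i\<close> for some \<open>y\<^sub>i\<close> (\<open>slice_factor_at_tindex\<close>).

  On a single slice, the statement concerns a matrix \<open>a\<close> with \<open>a ^ k = a ^ (k + 1) * y\<close> and a full
  rank factorization \<open>a ^ k = q * d * \<rho>\<close>, in which \<open>q\<close> has a left inverse, \<open>\<rho>\<close> a right inverse, and
  \<open>d\<close> an inverse. Writing \<open>a ^ k = a ^ k * a * a ^ k * z\<close> and cancelling \<open>q * d\<close> and \<open>\<rho>\<close> shows that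
  \<open>\<rho> * a * q\<close> has an inverse \<open>s\<close> (\<open>full_rank_factorization_core_invertible\<close>). As \<open>a\<close> commutes with
  \<open>a ^ k\<close>, there are \<open>g\<close> and \<open>h\<close> with \<open>a * q = q * g\<close> and \<open>\<rho> * a = h * \<rho>\<close>, whence \<open>g * s = s * h\<close> is
  the inverse of \<open>\<rho> * q\<close>. The Drazin equations for \<open>q * s * \<rho>\<close> follow by direct computation
  (\<open>full_rank_factorization_drazin\<close>). The solution of the Drazin equations is unique in every
  monoid (\<open>drazin_inverse_unique\<close>), in particular in that of square tensors under the C-product.
\<close>

section \<open>Rank and one-sided inverses\<close>

context vec_space begin

lemma col_space_mult_subset:
  assumes A: "A \<in> carrier_mat n m" and Z: "Z \<in> carrier_mat m l"
  shows "col_space (A * Z) \<subseteq> col_space A"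
proof
  fix y assume "y \<in> col_space (A * Z)"
  then obtain x where x: "x \<in> carrier_vec l" and y: "(A * Z) *\<^sub>v x = y" "y \<in> carrier_vec n"
    using A Z by (auto simp: col_space_eq[of _ l])
  have "A *\<^sub>v (Z *\<^sub>v x) = y" using A Z x y by (simp add: assoc_mult_mat_vec)
  moreover have "Z *\<^sub>v x \<in> carrier_vec m" using Z x by simp
  ultimately show "y \<in> col_space A" using A y by (auto simp: col_space_eq[OF A])
qed

lemma col_space_subset_imp_factor:
  assumes A: "A \<in> carrier_mat n m" and B: "B \<in> carrier_mat n l"
    and sub: "col_space A \<subseteq> col_space B"
  shows "\<exists>Y \<in> carrier_mat l m. A = B * Y"
proof -
  have "\<exists>x \<in> carrier_vec l. B *\<^sub>v x = col A j" if j: "j < m" for j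
  proof -
    have "col A j \<in> col_space A"
      unfolding col_space_def using A j cols_dim[of A] by (intro span_mem) (auto simp: cols_def)
    then show ?thesis using sub B by (auto simp: col_space_eq[OF B])
  qed
  then obtain f where f: "\<And>j. j < m \<Longrightarrow> f j \<in> carrier_vec l" "\<And>j. j < m \<Longrightarrow> B *\<^sub>v f j = col A j"
    by metis
  define Y where "Y = mat_of_cols l (map f [0..<m])"
  have Y: "Y \<in> carrier_mat l m" by (simp add: Y_def mat_of_cols_def)
  have "A = B * Y"
  proof (rule mat_col_eqI)
    fix j assume "j < dim_col (B * Y)"
    then have j: "j < m" using Y by simp
    then have "col Y j = f j" using f(1) by (simp add: Y_def)
    then show "col A j = col (B * Y) j" using col_mult2[OF B Y j] f(2)[OF j] by metis
  qed (use A B Y in auto)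
  with Y show ?thesis by blast
qed

lemma rank_eq_dim_col_space: "rank A = vectorspace.dim class_ring (vs (col_space A))"
  by (simp add: rank_def col_space_def)

lemma subspace_col_space:
  assumes "A \<in> carrier_mat n m"
  shows "subspace class_ring (col_space A) V" "vectorspace class_ring (vs (col_space A))"
    "vectorspace.fin_dim class_ring (vs (col_space A))"
proof -
  show *: "subspace class_ring (col_space A) V"
    unfolding col_space_def using assms cols_dim[of A] by (intro span_is_subspace) auto
  show "vectorspace class_ring (vs (col_space A))" using subspace_is_vs[OF *] .
  show "vectorspace.fin_dim class_ring (vs (col_space A))"
    unfolding col_space_def using fin_dim_span_cols[OF assms] .
qed

lemma rank_mult_le:
  assumes A: "A \<in> carrier_mat n m" and Z: "Z \<in> carrier_mat m l"
  shows "rank (A * Z) \<le> rank A"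
proof -
  have AZ: "A * Z \<in> carrier_mat n l" using A Z by simp
  have "subspace class_ring (col_space (A * Z)) (vs (col_space A))"
    by (rule nested_subspaces[OF subspace_col_space(1)[OF A] subspace_col_space(1)[OF AZ]
          col_space_mult_subset[OF A Z]])
  from vectorspace.subspace_dim[OF subspace_col_space(2)[OF A] this]
  show ?thesis
    using subspace_col_space[OF A] subspace_col_space[OF AZ] by (simp add: rank_eq_dim_col_space)
qed

text \<open>
  The column space of \<open>A * Z\<close> always lies in that of \<open>A\<close>; if the dimensions agree, a basis of the
  smaller space is already a basis of the larger one. This turns an equality of ranks into an
  equation between matrices, the form in which the index of a matrix is used below.
\<close>

lemma rank_mult_eq_imp_factor:
  assumes A: "A \<in> carrier_mat n m" and Z: "Z \<in> carrier_mat m l"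
    and rank: "rank (A * Z) = rank A"
  shows "\<exists>Y \<in> carrier_mat l m. A = A * Z * Y"
proof -
  have AZ: "A * Z \<in> carrier_mat n l" using A Z by simp
  note VA = subspace_col_space[OF A] and VB = subspace_col_space[OF AZ]
  interpret VA: vectorspace class_ring "vs (col_space A)" by (rule VA(2))
  interpret VB: vectorspace class_ring "vs (col_space (A * Z))" by (rule VB(2))
  obtain b where finb: "finite b" and b: "VB.basis b" using VB.finite_basis_exists[OF VB(3)] by blast
  have sub: "submodule class_ring (col_space A) V" "submodule class_ring (col_space (A * Z)) V"
    using VA(1) VB(1) by (simp_all add: subspace_def)
  have bB: "b \<subseteq> col_space (A * Z)" using b by (simp add: VB.basis_def)
  then have bA: "b \<subseteq> col_space A" using col_space_mult_subset[OF A Z] by blast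
  have "lin_indpt b"
    using b span_li_not_depend(2)[OF bB sub(2)] by (simp add: VB.basis_def)
  then have "VA.lin_indpt b" using span_li_not_depend(2)[OF bA sub(1)] by simp
  moreover have "card b = VA.dim"
    using rank VB.dim_basis[OF finb b] by (simp add: rank_eq_dim_col_space)
  ultimately have "VA.basis b"
    using VA.dim_li_is_basis[OF VA(3) finb] bA by simp
  then have "span b = col_space A"
    using span_li_not_depend(1)[OF bA sub(1)] by (simp add: VA.basis_def)
  moreover have "span b = col_space (A * Z)"
    using b span_li_not_depend(1)[OF bB sub(2)] by (simp add: VB.basis_def)
  ultimately have "col_space A \<subseteq> col_space (A * Z)" by simp
  from col_space_subset_imp_factor[OF A AZ this] show ?thesis .
qed

text \<open>
  The previous lemma for the product of the identity with \<open>A\<close>.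
\<close>

lemma full_row_rank_imp_right_inverse:
  assumes A: "A \<in> carrier_mat n m" and rank: "rank A = n"
  shows "\<exists>Y \<in> carrier_mat m n. A * Y = 1\<^sub>m n"
proof -
  have "rank (1\<^sub>m n) = n" using low_rank_det_zero[of "1\<^sub>m n"] by simp
  then have "rank (1\<^sub>m n * A) = rank (1\<^sub>m n)" using A rank by simp
  then obtain Y where Y: "Y \<in> carrier_mat m n" "1\<^sub>m n = 1\<^sub>m n * A * Y"
    using rank_mult_eq_imp_factor[OF one_carrier_mat A] by blast
  then have "A * Y = 1\<^sub>m n" using A by simp
  with Y(1) show ?thesis by blast
qed

text \<open>
  A repeated column would make the rank smaller than the number of columns, so the columns are
  distinct and hence linearly independent as a set.
\<close>

lemma full_column_rank_imp_injective:
  assumes A: "A \<in> carrier_mat n m" and rank: "rank A = m"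
    and v: "v \<in> carrier_vec m" and Av: "A *\<^sub>v v = 0\<^sub>v n"
  shows "v = 0\<^sub>v m"
proof -
  obtain S where S: "maximal S (\<lambda>T. T \<subseteq> set (cols A) \<and> lin_indpt T)"
    using maximal_exists[of "(\<lambda>T. T \<subseteq> set (cols A) \<and> lin_indpt T)" "card (set (cols A))" "{}"]
    by (meson List.finite_set card_mono empty_iff empty_subsetI finite_lin_indpt2 rev_finite_subset)
  then have "m \<le> card (set (cols A))"
    using rank_card_indpt[OF A S] rank by (simp add: card_mono maximal_def)
  then have d: "distinct (cols A)"
    using A card_length[of "cols A"] by (intro card_distinct) auto
  then show ?thesis
    using full_rank_lin_indpt[OF A rank d] lin_depI[OF A v _ Av d] by blast
qed

end

lemma det_nonzero_imp_left_inverse: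
  fixes B :: "'a :: field mat"
  assumes "B \<in> carrier_mat n n" "det B \<noteq> 0"
  shows "\<exists>C \<in> carrier_mat n n. C * B = 1\<^sub>m n"
  using det_non_zero_imp_unit[OF assms, of "()"] by (auto simp: Units_def ring_mat_def)

text \<open>
  The Gram matrix \<open>H * A\<close>, with \<open>H\<close> the conjugate transpose of \<open>A\<close>, is nonsingular: from
  \<open>H * A * v = 0\<close> it follows that \<open>w = A * v\<close> satisfies \<open>\<Sum>j. |w\<^sub>j|\<^sup>2 = 0\<close>, so \<open>v = 0\<close> by
  injectivity of \<open>A\<close>.
\<close>

lemma full_column_rank_imp_left_inverse:
  fixes A :: "complex mat"
  assumes A: "A \<in> carrier_mat n m" and rank: "vec_space.rank n A = m"
  shows "\<exists>Y \<in> carrier_mat m n. Y * A = 1\<^sub>m m"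
proof -
  define H where "H = mat m n (\<lambda>(i, j). cnj (A $$ (j, i)))"
  have H: "H \<in> carrier_mat m n" by (simp add: H_def)
  have "v = 0\<^sub>v m" if v: "v \<in> carrier_vec m" and 0: "H * A *\<^sub>v v = 0\<^sub>v m" for v
  proof -
    define w where "w = A *\<^sub>v v"
    have w: "w \<in> carrier_vec n" using A v by (simp add: w_def)
    have Hw: "H *\<^sub>v w = 0\<^sub>v m" using 0 H A v by (simp add: w_def assoc_mult_mat_vec)
    have "(\<Sum>j<n. complex_of_real ((cmod (w $ j))\<^sup>2)) = (\<Sum>j<n. cnj (w $ j) * w $ j)"
      by (intro sum.cong refl) (metis complex_norm_square mult.commute)
    also have "\<dots> = (\<Sum>j<n. \<Sum>i<m. cnj (v $ i) * (cnj (A $$ (j, i)) * w $ j))"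
      using A v by (intro sum.cong refl)
        (simp add: w_def scalar_prod_def atLeast0LessThan sum_distrib_right sum_distrib_left mult_ac)
    also have "\<dots> = (\<Sum>i<m. cnj (v $ i) * (\<Sum>j<n. cnj (A $$ (j, i)) * w $ j))"
      by (subst sum.swap) (simp add: sum_distrib_left)
    also have "\<dots> = (\<Sum>i<m. cnj (v $ i) * (H *\<^sub>v w) $ i)"
      using A w by (intro sum.cong refl) (simp add: H_def scalar_prod_def atLeast0LessThan)
    also have "\<dots> = 0" by (simp add: Hw)
    finally have "(\<Sum>j<n. (cmod (w $ j))\<^sup>2) = 0"
      by (metis of_real_sum of_real_eq_0_iff)
    then have "w = 0\<^sub>v n" using w by (intro eq_vecI) (auto simp: sum_nonneg_eq_0_iff)
    then show ?thesis using vec_space.full_column_rank_imp_injective[OF A rank v] by (simp add: w_def)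
  qed
  then have "det (H * A) \<noteq> 0"
    using det_0_iff_vec_prod_zero_field[of "H * A" m] H A by auto
  then obtain C where C: "C \<in> carrier_mat m m" "C * (H * A) = 1\<^sub>m m"
    using det_nonzero_imp_left_inverse[of "H * A" m] H A by auto
  then show ?thesis using H A by (intro bexI[of _ "C * H"]) auto
qed

section \<open>Drazin inverses from full rank factorizations\<close>

text \<open>
  With \<open>e = x \<otimes> a\<close> and \<open>f = a \<otimes> y\<close>, idempotency and commutation give \<open>e = x [^] Suc k \<otimes> a [^] Suc k\<close>
  and \<open>f = a [^] Suc k \<otimes> y [^] Suc k\<close>. Multiplication by \<open>f\<close> on the right fixes \<open>a [^] Suc k\<close>, and
  multiplication by \<open>e\<close> on the left fixes it as well, so \<open>e = e \<otimes> f = f\<close>; then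
  \<open>x = e \<otimes> x = y \<otimes> a \<otimes> x = y \<otimes> e = y \<otimes> f = y\<close>.
\<close>

lemma (in monoid) drazin_inverse_unique:
  fixes k :: nat
  assumes carr: "a \<in> carrier G" "x \<in> carrier G" "y \<in> carrier G"
    and x: "a [^] Suc k \<otimes> x = a [^] k" "x \<otimes> a \<otimes> x = x" "a \<otimes> x = x \<otimes> a"
    and y: "a [^] Suc k \<otimes> y = a [^] k" "y \<otimes> a \<otimes> y = y" "a \<otimes> y = y \<otimes> a"
  shows "x = y"
proof -
  have idem: "(u \<otimes> a) [^] Suc n = u \<otimes> a"
    if "u \<in> carrier G" "u \<otimes> a \<otimes> u = u" for u and n :: nat
  proof (induction n)
    case (Suc n)
    then show ?case using that carr by (simp add: m_assoc[symmetric])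
  qed (use that carr in simp)
  have e: "x \<otimes> a = x [^] Suc k \<otimes> a [^] Suc k"
    using idem[OF carr(2) x(2), of k] pow_mult_distrib[OF x(3)[symmetric] carr(2,1), of "Suc k"] by simp
  have f: "a \<otimes> y = a [^] Suc k \<otimes> y [^] Suc k"
    using idem[OF carr(3) y(2), of k] pow_mult_distrib[OF y(3) carr(1,3), of "Suc k"] y(3) by simp
  have comm: "x \<otimes> a [^] Suc k = a [^] Suc k \<otimes> x"
    using group_commutes_pow[OF x(3) carr(1,2), of "Suc k"] by simp
  have shift: "a [^] Suc k \<otimes> a = a \<otimes> a [^] Suc k" "a [^] Suc k = a \<otimes> a [^] k"
    using carr nat_pow_comm[of a "Suc k" 1] nat_pow_Suc2[of a k] by simp_all
  have "(x \<otimes> a) \<otimes> (a \<otimes> y) = x [^] Suc k \<otimes> ((a [^] Suc k \<otimes> a) \<otimes> y)"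
    unfolding e using carr by (simp add: m_assoc del: nat_pow_Suc)
  also have "\<dots> = x [^] Suc k \<otimes> (a \<otimes> (a [^] Suc k \<otimes> y))"
    unfolding shift(1) using carr by (simp add: m_assoc del: nat_pow_Suc)
  also have "\<dots> = x \<otimes> a" using y(1) shift(2) e by simp
  finally have ef_e: "(x \<otimes> a) \<otimes> (a \<otimes> y) = x \<otimes> a" .
  have "(x \<otimes> a) \<otimes> (a \<otimes> y) = a \<otimes> ((x \<otimes> a [^] Suc k) \<otimes> y [^] Suc k)"
    unfolding f x(3)[symmetric] using carr by (simp add: m_assoc del: nat_pow_Suc)
  also have "\<dots> = (a \<otimes> a [^] k) \<otimes> y [^] Suc k"
    unfolding comm x(1) using carr by (simp add: m_assoc del: nat_pow_Suc)
  also have "\<dots> = a \<otimes> y" using shift(2) f by simp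
  finally have ef: "x \<otimes> a = a \<otimes> y" using ef_e by simp
  have "x = (x \<otimes> a) \<otimes> x" using x(2) by simp
  also have "\<dots> = y \<otimes> (a \<otimes> x)" using ef y(3) carr by (simp add: m_assoc)
  also have "\<dots> = y \<otimes> (a \<otimes> y)" using ef x(3) by simp
  also have "\<dots> = y" using y(2) carr by (simp add: m_assoc)
  finally show ?thesis .
qed

text \<open>
  Associativity with side conditions on dimensions, which the simplifier can solve by rewriting;
  the carrier form leaves it to guess the intermediate dimensions of rectangular factors.
\<close>

lemma assoc_mult_mat_dim:
  fixes A B C :: "'a :: semiring_0 mat"
  assumes "dim_col A = dim_row B" "dim_col B = dim_row C"
  shows "A * B * C = A * (B * C)"
  using assms
  by (intro assoc_mult_mat[of A "dim_row A" "dim_col A" B "dim_col B" C "dim_col C"]) auto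

lemma pow_mat_add:
  fixes a :: "'a :: semiring_1 mat"
  assumes "a \<in> carrier_mat n n"
  shows "a ^\<^sub>m (i + j) = a ^\<^sub>m i * a ^\<^sub>m j"
proof (induction j)
  case (Suc j)
  then show ?case using assms by (simp add: assoc_mult_mat[of _ n n _ n _ n])
qed (use assms in simp)

text \<open>
  If the range of \<open>a ^ k\<close> does not shrink in one further step, it never shrinks again.
\<close>

lemma pow_mat_factor_iterate:
  fixes a :: "'a :: semiring_1 mat"
  assumes a: "a \<in> carrier_mat n n" and y: "y \<in> carrier_mat n n"
    and eq: "a ^\<^sub>m k = a ^\<^sub>m Suc k * y"
  shows "\<exists>z \<in> carrier_mat n n. a ^\<^sub>m k = a ^\<^sub>m (k + m) * z"
proof (induction m)
  case 0
  show ?case using a by (intro bexI[of _ "1\<^sub>m n"]) auto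
next
  case (Suc m)
  then obtain z where z: "z \<in> carrier_mat n n" "a ^\<^sub>m k = a ^\<^sub>m (k + m) * z" by blast
  note [simp] = assoc_mult_mat[of _ n n _ n _ n]
  have "a ^\<^sub>m (k + m) = a ^\<^sub>m m * a ^\<^sub>m k" using pow_mat_add[OF a, of m k] by (simp add: add.commute)
  also have "\<dots> = a ^\<^sub>m m * (a ^\<^sub>m Suc k * y)" by (simp only: eq)
  also have "\<dots> = (a ^\<^sub>m m * a ^\<^sub>m Suc k) * y"
    using carrier_matD[OF a] carrier_matD[OF y] by (simp add: assoc_mult_mat_dim del: assoc_mult_mat)
  also have "a ^\<^sub>m m * a ^\<^sub>m Suc k = a ^\<^sub>m (k + Suc m)"
    using pow_mat_add[OF a, of m "Suc k"] by (simp add: add.commute)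
  finally have "a ^\<^sub>m (k + m) = a ^\<^sub>m (k + Suc m) * y" .
  then have "a ^\<^sub>m k = a ^\<^sub>m (k + Suc m) * y * z" using z(2) by metis
  also have "\<dots> = a ^\<^sub>m (k + Suc m) * (y * z)" using z(1) a y by (intro assoc_mult_mat) auto
  finally have "a ^\<^sub>m k = a ^\<^sub>m (k + Suc m) * (y * z)" .
  then show ?case using y z by (intro bexI[of _ "y * z"]) auto
qed

text \<open>
  Iterating the stabilization of the powers up to the exponent \<open>2 * k + 1\<close> gives
  \<open>a ^ k = a ^ k * a * a ^ k * z\<close>. Inserting the factorization of \<open>a ^ k\<close> on both sides, the factor
  \<open>q * d\<close> cancels on the left and \<open>\<rho>\<close> on the right, and a right inverse of \<open>\<rho> * a * q\<close> remains.
\<close>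

lemma full_rank_factorization_core_invertible:
  fixes a q d \<rho> :: "complex mat"
  assumes a: "a \<in> carrier_mat n n" and q: "q \<in> carrier_mat n r"
    and d: "d \<in> carrier_mat r r" and \<rho>: "\<rho> \<in> carrier_mat r n"
    and q': "q' \<in> carrier_mat r n" "q' * q = 1\<^sub>m r"
    and \<rho>': "\<rho>' \<in> carrier_mat n r" "\<rho> * \<rho>' = 1\<^sub>m r"
    and d': "d' \<in> carrier_mat r r" "d' * d = 1\<^sub>m r"
    and fac: "a ^\<^sub>m k = q * d * \<rho>"
    and y: "y \<in> carrier_mat n n" "a ^\<^sub>m k = a ^\<^sub>m Suc k * y"
  shows "\<exists>s \<in> carrier_mat r r. \<rho> * a * q * s = 1\<^sub>m r"
proof -
  obtain z where z: "z \<in> carrier_mat n n" "a ^\<^sub>m k = a ^\<^sub>m (k + Suc k) * z"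
    using pow_mat_factor_iterate[OF a y] by blast
  note dims = carrier_matD[OF q] carrier_matD[OF d] carrier_matD[OF \<rho>] carrier_matD[OF a]
    carrier_matD[OF q'(1)] carrier_matD[OF \<rho>'(1)] carrier_matD[OF d'(1)] carrier_matD[OF z(1)]
  have "a ^\<^sub>m (k + Suc k) = a ^\<^sub>m k * a * a ^\<^sub>m k"
    using pow_mat_add[OF a, of "Suc k" k] by (simp add: add.commute)
  then have eq: "q * d * \<rho> = q * d * \<rho> * a * (q * d * \<rho>) * z"
    using z(2) by (simp only: fac)
  have "d' * q' * (q * d * v) = v" if "v \<in> carrier_mat r n" for v
  proof -
    have "d' * q' * (q * d * v) = d' * ((q' * q) * (d * v))"
      using carrier_matD[OF q] carrier_matD[OF d] carrier_matD[OF q'(1)] carrier_matD[OF d'(1)]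
        carrier_matD[OF that] by (simp add: assoc_mult_mat_dim del: assoc_mult_mat)
    also have "\<dots> = (d' * d) * v" using q'(2) d d'(1) that by simp
    finally show ?thesis using d'(2) that by simp
  qed
  note cancel = this
  have "\<rho> = d' * q' * (q * d * \<rho>)" using cancel[OF \<rho>] by simp
  also have "\<dots> = d' * q' * (q * d * \<rho> * a * (q * d * \<rho>) * z)"
    by (simp only: eq[symmetric])
  also have "\<dots> = d' * q' * (q * d * (\<rho> * a * (q * d * \<rho>) * z))"
    by (simp add: dims assoc_mult_mat_dim del: assoc_mult_mat)
  also have "\<dots> = \<rho> * a * (q * d * \<rho>) * z" using a q d \<rho> z(1) by (intro cancel) auto
  finally have "1\<^sub>m r = \<rho> * a * (q * d * \<rho>) * z * \<rho>'" using \<rho>'(2) by simp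
  also have "\<dots> = \<rho> * a * q * (d * \<rho> * z * \<rho>')" by (simp add: dims assoc_mult_mat_dim del: assoc_mult_mat)
  finally show ?thesis
    using d \<rho> z(1) \<rho>'(1) by (intro bexI[of _ "d * \<rho> * z * \<rho>'"]) auto
qed

text \<open>
  The column space of \<open>q\<close> and the row space of \<open>\<rho>\<close> are those of \<open>a ^ k\<close>, hence invariant under
  \<open>a\<close>: there are square \<open>g\<close> and \<open>h\<close> with \<open>a * q = q * g\<close> and \<open>\<rho> * a = h * \<rho>\<close>. The inverse \<open>s\<close> of
  \<open>\<rho> * a * q = \<rho> * q * g = h * \<rho> * q\<close> then makes \<open>g * s\<close> a right and \<open>s * h\<close> a left inverse of
  \<open>\<rho> * q\<close>. So these two agree, which is what makes \<open>x = q * s * \<rho>\<close> commute with \<open>a\<close>, and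
  \<open>a * x = q * (g * s) * \<rho>\<close> is the projection onto the range of \<open>a ^ k\<close>.
\<close>

lemma full_rank_factorization_drazin:
  fixes a q d \<rho> s :: "complex mat"
  assumes a: "a \<in> carrier_mat n n" and q: "q \<in> carrier_mat n r"
    and d: "d \<in> carrier_mat r r" and \<rho>: "\<rho> \<in> carrier_mat r n"
    and q': "q' \<in> carrier_mat r n" "q' * q = 1\<^sub>m r"
    and \<rho>': "\<rho>' \<in> carrier_mat n r" "\<rho> * \<rho>' = 1\<^sub>m r"
    and d': "d' \<in> carrier_mat r r" "d' * d = 1\<^sub>m r"
    and fac: "a ^\<^sub>m k = q * d * \<rho>"
    and s: "s \<in> carrier_mat r r" "\<rho> * a * q * s = 1\<^sub>m r"
  defines "x \<equiv> q * s * \<rho>"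
  shows "a ^\<^sub>m Suc k * x = a ^\<^sub>m k" "x * a * x = x" "a * x = x * a"
proof -
  have dd': "d * d' = 1\<^sub>m r" using mat_mult_left_right_inverse[OF d'(1) d d'(2)] .
  have c: "\<rho> * a * q \<in> carrier_mat r r" using a q \<rho> by simp
  have s': "s * (\<rho> * a * q) = 1\<^sub>m r" using mat_mult_left_right_inverse[OF c s] .
  note dims = carrier_matD[OF q] carrier_matD[OF d] carrier_matD[OF \<rho>] carrier_matD[OF a]
    carrier_matD[OF q'(1)] carrier_matD[OF \<rho>'(1)] carrier_matD[OF d'(1)] carrier_matD[OF s(1)]
  \<comment> \<open>Solve \<open>a * q = q * g\<close> and \<open>\<rho> * a = h * \<rho>\<close> by cancelling in \<open>a * a ^ k = a ^ k * a\<close>.\<close>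
  define g where "g = d * \<rho> * a * \<rho>' * d'"
  define h where "h = d' * q' * a * q * d"
  have g: "g \<in> carrier_mat r r" by (rule carrier_matI) (simp_all add: g_def dims)
  have h: "h \<in> carrier_mat r r" by (rule carrier_matI) (simp_all add: h_def dims)
  have comm: "a * (q * d * \<rho>) = q * d * \<rho> * a"
    using pow_mat_add[OF a, of 1 k] pow_mat_add[OF a, of k 1] a by (simp add: fac)
  have "q * g = (q * d * \<rho> * a) * \<rho>' * d'"
    by (simp add: g_def dims assoc_mult_mat_dim del: assoc_mult_mat)
  also have "\<dots> = a * q * d * (\<rho> * \<rho>') * d'"
    unfolding comm[symmetric] by (simp add: dims assoc_mult_mat_dim del: assoc_mult_mat)
  also have "\<dots> = a * q"
    by (simp add: \<rho>'(2) dd' dims assoc_mult_mat_dim left_mult_one_mat[OF d'(1)]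
        right_mult_one_mat[OF q] del: assoc_mult_mat)
  finally have qg: "a * q = q * g" by simp
  have "h * \<rho> = d' * q' * (a * (q * d * \<rho>))"
    by (simp add: h_def dims assoc_mult_mat_dim del: assoc_mult_mat)
  also have "\<dots> = d' * (q' * q) * d * (\<rho> * a)"
    unfolding comm by (simp add: dims assoc_mult_mat_dim del: assoc_mult_mat)
  also have "\<dots> = \<rho> * a"
    using left_mult_one_mat[OF d] left_mult_one_mat[OF mult_carrier_mat[OF \<rho> a]]
    by (simp add: q'(2) d'(2) assoc_mult_mat[OF d'(1) _ d] dims del: assoc_mult_mat)
  finally have h\<rho>: "\<rho> * a = h * \<rho>" by simp
  note dims = dims carrier_matD[OF g] carrier_matD[OF h]
  have right: "\<rho> * q * (g * s) = 1\<^sub>m r"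
  proof -
    have "\<rho> * q * (g * s) = \<rho> * (q * g) * s" by (simp add: dims assoc_mult_mat_dim del: assoc_mult_mat)
    also have "\<dots> = 1\<^sub>m r" unfolding qg[symmetric] using a q \<rho> s by simp
    finally show ?thesis .
  qed
  have left: "s * h * (\<rho> * q) = 1\<^sub>m r"
  proof -
    have "s * h * (\<rho> * q) = s * ((h * \<rho>) * q)" by (simp add: dims assoc_mult_mat_dim del: assoc_mult_mat)
    then show ?thesis unfolding h\<rho>[symmetric] using s' by simp
  qed
  have "g * s = (s * h * (\<rho> * q)) * (g * s)" using g s(1) by (simp add: left)
  also have "\<dots> = s * h * (\<rho> * q * (g * s))" by (simp add: dims assoc_mult_mat_dim del: assoc_mult_mat)
  also have "\<dots> = s * h" using h s(1) by (simp add: right)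
  finally have gs: "g * s = s * h" .
  have ax: "a * x = q * (g * s) * \<rho>"
  proof -
    have "a * x = (a * q) * s * \<rho>" unfolding x_def by (simp add: dims assoc_mult_mat_dim del: assoc_mult_mat)
    then show ?thesis unfolding qg by (simp add: dims assoc_mult_mat_dim del: assoc_mult_mat)
  qed
  also have "\<dots> = q * s * (\<rho> * a)" unfolding gs h\<rho> by (simp add: dims assoc_mult_mat_dim del: assoc_mult_mat)
  finally show "a * x = x * a" unfolding x_def by (simp add: dims assoc_mult_mat_dim del: assoc_mult_mat)
  have "x * a * x = q * (s * (\<rho> * a * q)) * (s * \<rho>)"
    unfolding x_def by (simp add: dims assoc_mult_mat_dim del: assoc_mult_mat)
  then show "x * a * x = x" unfolding s' x_def using q s(1) \<rho> by simp
  have x: "x \<in> carrier_mat n n" using q s(1) \<rho> by (simp add: x_def)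
  have "a ^\<^sub>m Suc k * x = a ^\<^sub>m k * (a * x)" using a x by (simp add: assoc_mult_mat[of _ n n _ n _ n])
  also have "\<dots> = q * d * (\<rho> * q * (g * s)) * \<rho>"
    unfolding ax fac by (simp add: dims assoc_mult_mat_dim del: assoc_mult_mat)
  also have "\<dots> = a ^\<^sub>m k" unfolding fac right using q d \<rho> by simp
  finally show "a ^\<^sub>m Suc k * x = a ^\<^sub>m k" .
qed

section \<open>The cosine transform\<close>

text \<open>
  The samples \<open>cos ((2 * p + 1) * k * \<pi> / (2 * n))\<close>, which up to scaling form the \<open>k\<close>-th row of the
  cosine transform, are extended to all integer positions \<open>p\<close>: the two reflection symmetries of
  this extension are what the Hankel part of the block matrix encodes.
\<close>

definition cos_wave :: "nat \<Rightarrow> nat \<Rightarrow> int \<Rightarrow> real" where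
  "cos_wave n k p = cos ((2 * of_int p + 1) * (real k * pi / (2 * real n)))"

text \<open>
  Multiplication by \<open>2 * sin x\<close> makes the sum telescope.
\<close>

lemma sum_cos_odd_multiples:
  "2 * sin x * (\<Sum>l<n. cos ((2 * real l + 1) * x)) = sin (2 * real n * x)"
proof (induction n)
  case (Suc n)
  have "2 * sin x * cos ((2 * real n + 1) * x) = sin (2 * real (Suc n) * x) - sin (2 * real n * x)"
    using sin_add[of "(2 * real n + 1) * x" x] sin_diff[of "(2 * real n + 1) * x" x]
    by (simp add: algebra_simps)
  then show ?case using Suc by (simp add: distrib_left)
qed simp

lemma sum_cos_wave_eq_0:
  assumes "0 < m" "m < 2 * n"
  shows "(\<Sum>l<n. cos_wave n m (int l)) = 0"
proof -
  define x where "x = real m * pi / (2 * real n)"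
  have n: "real n > 0" using assms by simp
  have "x < pi" using assms n by (simp add: x_def field_simps)
  moreover have "0 < x" using assms n by (simp add: x_def)
  ultimately have "sin x \<noteq> 0" using sin_gt_zero by force
  moreover have "2 * real n * x = real m * pi" using n by (simp add: x_def)
  then have "sin (2 * real n * x) = 0" by simp
  ultimately show ?thesis
    using sum_cos_odd_multiples[of x n] by (simp add: cos_wave_def x_def)
qed

lemma cos_wave_mult:
  assumes "j' \<le> j"
  shows "cos_wave n j p * cos_wave n j' p = (cos_wave n (j - j') p + cos_wave n (j + j') p) / 2"
  using assms unfolding cos_wave_def
  by (subst cos_times_cos) (simp add: of_nat_diff algebra_simps add_divide_distrib diff_divide_distrib)

lemma cos_wave_shift:
  "2 * cos (2 * real l * (real k * pi / (2 * real n))) * cos_wave n k p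
     = cos_wave n k (p + int l) + cos_wave n k (p - int l)"
proof -
  define x where "x = real k * pi / (2 * real n)"
  have "(2 * of_int (p + int l) + 1) * x = (2 * of_int p + 1) * x + 2 * real l * x"
    "(2 * of_int (p - int l) + 1) * x = (2 * of_int p + 1) * x - 2 * real l * x"
    by (simp_all add: algebra_simps)
  then show ?thesis unfolding cos_wave_def x_def[symmetric] by (simp add: cos_add cos_diff)
qed

text \<open>
  Even symmetry about the left border \<open>-1/2\<close> and about the right border \<open>n - 1/2\<close>.
\<close>

lemma cos_wave_reflect: "cos_wave n k (- 1 - p) = cos_wave n k p"
proof -
  define x where "x = real k * pi / (2 * real n)"
  have "(2 * of_int (- 1 - p) + 1) * x = - ((2 * of_int p + 1) * x)" by (simp add: algebra_simps)
  then show ?thesis unfolding cos_wave_def x_def[symmetric] by simp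
qed

lemma cos_wave_reflect_end:
  assumes "0 < n"
  shows "cos_wave n k (2 * int n - 1 - p) = cos_wave n k p"
proof -
  define x where "x = real k * pi / (2 * real n)"
  have "4 * real n * x = 2 * pi * real k" using assms by (simp add: x_def)
  then have "(2 * of_int (2 * int n - 1 - p) + 1) * x = 2 * pi * real k - (2 * of_int p + 1) * x"
    by (simp add: algebra_simps)
  moreover have "cos (2 * pi * real k - y) = cos y" for y
    using cos_diff[of "2 * pi * real k" y] sin_times_pi_eq_0[of "2 * real k"] cos_int_2pin[of "int k"]
    by (simp add: mult_ac)
  ultimately show ?thesis by (simp add: cos_wave_def x_def)
qed

lemma cos_wave_0_pos:
  assumes "k < n"
  shows "cos_wave n k 0 > 0"
proof -
  have "real k * pi / (2 * real n) < pi / 2" using assms by (simp add: field_simps)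
  moreover have "- (pi / 2) < real k * pi / (2 * real n)"
    by (rule less_le_trans[of _ 0]) auto
  ultimately show ?thesis unfolding cos_wave_def by (simp add: cos_gt_zero_pi)
qed

definition dct_scale :: "nat \<Rightarrow> nat \<Rightarrow> real" where
  "dct_scale n j = sqrt ((2 - (if j = 0 then 1 else 0)) / real n)"

lemma dct_mat_index:
  "j < n \<Longrightarrow> l < n \<Longrightarrow> dct_mat n $$ (j, l) = complex_of_real (dct_scale n j * cos_wave n j (int l))"
  by (simp add: dct_mat_def dct_scale_def cos_wave_def mult_ac)

lemma dct_scale_pos: "0 < n \<Longrightarrow> dct_scale n j > 0"
  by (simp add: dct_scale_def)

lemma dct_scale_square: "0 < n \<Longrightarrow> dct_scale n j * dct_scale n j = (if j = 0 then 1 else 2) / real n"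
  by (simp add: dct_scale_def)

lemma dct_mat_carrier [simp]: "dct_mat n \<in> carrier_mat n n"
  by (simp add: dct_mat_def)

text \<open>
  By the product formula, the inner product of the waves \<open>j\<close> and \<open>j'\<close> is half the sum of the entry
  sums of the waves \<open>j - j'\<close> and \<open>j + j'\<close>. Both indices are less than \<open>2 * n\<close>, so only the index \<open>0\<close>
  contributes; it occurs twice if \<open>j = j' = 0\<close>, which the scaling of the first row accounts for.
\<close>

lemma dct_rows_orthonormal:
  assumes "j < n" "j' < n"
  shows "(\<Sum>l<n. dct_scale n j * cos_wave n j (int l) * (dct_scale n j' * cos_wave n j' (int l)))
    = (if j = j' then 1 else 0)"
proof -
  have *: "(\<Sum>l<n. dct_scale n i * cos_wave n i (int l) * (dct_scale n i' * cos_wave n i' (int l)))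
    = (if i = i' then 1 else 0)" if le: "i' \<le> i" and i: "i < n" for i i'
  proof -
    have "(\<Sum>l<n. dct_scale n i * cos_wave n i (int l) * (dct_scale n i' * cos_wave n i' (int l)))
      = dct_scale n i * dct_scale n i' * (\<Sum>l<n. cos_wave n i (int l) * cos_wave n i' (int l))"
      by (simp add: sum_distrib_left mult_ac)
    also have "(\<Sum>l<n. cos_wave n i (int l) * cos_wave n i' (int l))
      = ((\<Sum>l<n. cos_wave n (i - i') (int l)) + (\<Sum>l<n. cos_wave n (i + i') (int l))) / 2"
      by (simp add: cos_wave_mult[OF le] sum.distrib sum_divide_distrib[symmetric])
    also have "(\<Sum>l<n. cos_wave n (i - i') (int l)) = (if i = i' then real n else 0)"
    proof (cases "i = i'")
      case True
      then show ?thesis by (simp add: cos_wave_def)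
    next
      case False
      then show ?thesis using le i by (simp add: sum_cos_wave_eq_0)
    qed
    also have "(\<Sum>l<n. cos_wave n (i + i') (int l)) = (if i = 0 then real n else 0)"
    proof (cases "i = 0")
      case True
      then show ?thesis using le by (simp add: cos_wave_def)
    next
      case False
      then show ?thesis using le i by (simp add: sum_cos_wave_eq_0)
    qed
    also have "dct_scale n i * dct_scale n i' *
        (((if i = i' then real n else 0) + (if i = 0 then real n else 0)) / 2)
      = (if i = i' then 1 else 0)"
      using dct_scale_square[of n i] i le by (auto simp: field_simps)
    finally show ?thesis .
  qed
  show ?thesis
  proof (cases "j' \<le> j")
    case True
    then show ?thesis using * assms by blast
  next
    case False
    have "(\<Sum>l<n. dct_scale n j * cos_wave n j (int l) * (dct_scale n j' * cos_wave n j' (int l)))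
      = (\<Sum>l<n. dct_scale n j' * cos_wave n j' (int l) * (dct_scale n j * cos_wave n j (int l)))"
      by (intro sum.cong refl mult.commute)
    then show ?thesis using *[of j j'] False assms by auto
  qed
qed

lemma det_dct_mat: "det (dct_mat n) \<noteq> 0"
proof -
  have "dct_mat n * transpose_mat (dct_mat n) = 1\<^sub>m n"
  proof (rule eq_matI)
    fix j j' assume "j < dim_row (1\<^sub>m n :: complex mat)" "j' < dim_col (1\<^sub>m n :: complex mat)"
    then have j: "j < n" "j' < n" by simp_all
    have "(dct_mat n * transpose_mat (dct_mat n)) $$ (j, j')
      = (\<Sum>l<n. dct_mat n $$ (j, l) * dct_mat n $$ (j', l))"
      using j carrier_matD[OF dct_mat_carrier[of n]]
      by (simp add: scalar_prod_def atLeast0LessThan)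
    also have "\<dots> = complex_of_real
      (\<Sum>l<n. dct_scale n j * cos_wave n j (int l) * (dct_scale n j' * cos_wave n j' (int l)))"
      using j by (simp add: dct_mat_index)
    also have "\<dots> = 1\<^sub>m n $$ (j, j')" using j by (simp only: dct_rows_orthonormal) simp
    finally show "(dct_mat n * transpose_mat (dct_mat n)) $$ (j, j') = 1\<^sub>m n $$ (j, j')" .
  qed (use carrier_matD[OF dct_mat_carrier[of n]] in simp_all)
  then have "det (dct_mat n) * det (transpose_mat (dct_mat n)) = 1"
    using det_mult[of "dct_mat n" n "transpose_mat (dct_mat n)"] by (simp add: transpose_carrier_mat)
  then show ?thesis by auto
qed

lemma W_mat_carrier [simp]: "W_mat n \<in> carrier_mat n n"
  by (simp add: W_mat_def)

lemma Z_mat_carrier [simp]: "Z_mat n \<in> carrier_mat n n"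
  by (simp add: Z_mat_def)

text \<open>
  The diagonal of \<open>W_mat\<close> consists of scaled cosines of angles below \<open>\<pi> / 2\<close>, so it has no zero and
  \<open>mat_inverse\<close> does return an inverse.
\<close>

lemma W_mat_inverse:
  shows "W_mat n * the (mat_inverse (W_mat n)) = 1\<^sub>m n"
    and "the (mat_inverse (W_mat n)) \<in> carrier_mat n n"
proof -
  have "det (W_mat n) = prod_list (diag_mat (W_mat n))"
    by (rule det_upper_triangular[of _ n]) (auto simp: W_mat_def)
  also have "\<dots> \<noteq> 0"
    using dct_scale_pos[of n] cos_wave_0_pos[of _ n]
    by (auto simp: prod_list_zero_iff diag_mat_def W_mat_def dct_mat_index less_imp_neq[symmetric])
  finally have "W_mat n \<in> Units (ring_mat TYPE(complex) n ())"
    by (intro det_non_zero_imp_unit) auto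
  then obtain B where B: "mat_inverse (W_mat n) = Some B"
    using mat_inverse(1)[OF W_mat_carrier[of n], where b = "()"] by (metis not_None_eq)
  from mat_inverse(2)[OF W_mat_carrier[of n] this]
  show "W_mat n * the (mat_inverse (W_mat n)) = 1\<^sub>m n"
    "the (mat_inverse (W_mat n)) \<in> carrier_mat n n" by (simp_all add: B)
qed

lemma M_mat_carrier [simp]: "M_mat n \<in> carrier_mat n n"
  unfolding M_mat_def using W_mat_inverse(2)[of n] by (intro mult_carrier_mat[of _ n n]) auto

lemma W_mult_M: "W_mat n * M_mat n = dct_mat n * (1\<^sub>m n + Z_mat n)"
proof -
  let ?V = "the (mat_inverse (W_mat n))"
  have "W_mat n * M_mat n = W_mat n * ?V * (dct_mat n * (1\<^sub>m n + Z_mat n))"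
    unfolding M_mat_def
    using carrier_matD[OF W_mat_inverse(2)[of n]] carrier_matD[OF W_mat_carrier[of n]]
      carrier_matD[OF dct_mat_carrier[of n]] carrier_matD[OF Z_mat_carrier[of n]]
    by (simp add: assoc_mult_mat_dim del: assoc_mult_mat)
  also have "\<dots> = dct_mat n * (1\<^sub>m n + Z_mat n)"
    unfolding W_mat_inverse(1) by (intro left_mult_one_mat[of _ n n] mult_carrier_mat[of _ n n]) auto
  finally show ?thesis .
qed

text \<open>
  From \<open>W * M = C * (I + Z)\<close>: multiplication by \<open>I + Z\<close> adds neighbouring columns of \<open>C\<close>, and the
  sum of the neighbouring cosines \<open>cos ((2 * l + 1) * x) + cos ((2 * l - 1) * x)\<close> is
  \<open>2 * cos (2 * l * x) * cos x\<close>, whose last factor is the one divided out by \<open>W\<close>.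
\<close>

lemma M_mat_index:
  assumes k: "k < n" and l: "l < n"
  shows "M_mat n $$ (k, l) = (if l = 0 then 1
    else complex_of_real (2 * cos (2 * real l * (real k * pi / (2 * real n)))))"
proof -
  have s: "dct_scale n k > 0" and c: "cos_wave n k 0 > 0"
    using k dct_scale_pos cos_wave_0_pos by simp_all
  have "W_mat n $$ (k, k) * M_mat n $$ (k, l) = (W_mat n * M_mat n) $$ (k, l)"
  proof -
    have "(W_mat n * M_mat n) $$ (k, l) = (\<Sum>i<n. W_mat n $$ (k, i) * M_mat n $$ (i, l))"
      using k l carrier_matD[OF M_mat_carrier[of n]] carrier_matD[OF W_mat_carrier[of n]]
      by (simp add: scalar_prod_def atLeast0LessThan)
    also have "\<dots> = (\<Sum>i<n. if i = k then W_mat n $$ (k, k) * M_mat n $$ (k, l) else 0)"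
      using k by (intro sum.cong) (auto simp: W_mat_def)
    finally show ?thesis using k by simp
  qed
  also have "\<dots> = (\<Sum>i<n. dct_mat n $$ (k, i) * (1\<^sub>m n + Z_mat n) $$ (i, l))"
    unfolding W_mult_M using k l carrier_matD[OF Z_mat_carrier[of n]] carrier_matD[OF dct_mat_carrier[of n]]
    by (simp add: scalar_prod_def atLeast0LessThan)
  also have "\<dots> = (\<Sum>i<n. (if i = l then dct_mat n $$ (k, l) else 0)
      + (if i = l - 1 then (if l = 0 then 0 else dct_mat n $$ (k, l - 1)) else 0))"
    using l by (intro sum.cong) (auto simp: Z_mat_def)
  also have "\<dots> = dct_mat n $$ (k, l) + (if l = 0 then 0 else dct_mat n $$ (k, l - 1))"
    using l by (simp add: sum.distrib)
  also have "\<dots> = complex_of_real (dct_scale n k *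
      (cos_wave n k (int l) + (if l = 0 then 0 else cos_wave n k (int l - 1))))"
    using k l by (simp add: dct_mat_index distrib_left of_nat_diff)
  also have "cos_wave n k (int l) + (if l = 0 then 0 else cos_wave n k (int l - 1))
      = cos_wave n k 0 * (if l = 0 then 1 else 2 * cos (2 * real l * (real k * pi / (2 * real n))))"
    using cos_wave_shift[of l k n 0] cos_wave_reflect[of n k "int l - 1"] by (simp add: mult_ac)
  finally have "complex_of_real (dct_scale n k * cos_wave n k 0) * M_mat n $$ (k, l) =
     complex_of_real (dct_scale n k * cos_wave n k 0) * complex_of_real
      (if l = 0 then 1 else 2 * cos (2 * real l * (real k * pi / (2 * real n))))"
    using k by (simp add: W_mat_def dct_mat_index mult_ac)
  then have "M_mat n $$ (k, l) = complex_of_real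
      (if l = 0 then 1 else 2 * cos (2 * real l * (real k * pi / (2 * real n))))"
    using s c by (subst (asm) mult_left_cancel) auto
  then show ?thesis by simp
qed

lemma det_M_mat: "det (M_mat n) \<noteq> 0"
proof -
  have "det (1\<^sub>m n + Z_mat n) = prod_list (diag_mat (1\<^sub>m n + Z_mat n))"
    by (rule det_upper_triangular[of _ n]) (auto simp: Z_mat_def)
  also have "diag_mat (1\<^sub>m n + Z_mat n) = map (\<lambda>i. 1) [0..<n]"
    by (auto simp: diag_mat_def Z_mat_def)
  also have "prod_list (map (\<lambda>i. 1 :: complex) [0..<n]) = 1" by (induction n) auto
  finally have "det (W_mat n * M_mat n) = det (dct_mat n)"
    unfolding W_mult_M by (subst det_mult[of _ n]) auto
  then show ?thesis using det_dct_mat[of n] det_mult[OF W_mat_carrier M_mat_carrier, of n] by auto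
qed

text \<open>
  The scalar core of the diagonalization: a cosine wave is a left eigenvector of the
  Toeplitz-plus-Hankel matrix of \<open>a\<close>, with the transformed coefficient as eigenvalue. Multiplying
  the wave by \<open>2 * cos (2 * l * x)\<close> adds its shifts by \<open>l\<close> in both directions. As long as the shifted
  position stays in \<open>{0..<n}\<close> it is a Toeplitz entry; when it leaves on the left or on the right,
  reflection at that border brings it back to a Hankel entry of the first or the second kind.
\<close>

lemma toeplitz_hankel_cos_wave:
  fixes a :: "nat \<Rightarrow> complex"
  assumes k: "k < n" and q: "q < n"
  defines "h \<equiv> \<lambda>p. if p + q + 1 < n then a (p + q + 1) else if p + q + 1 = n then 0
    else a (2 * n - 1 - p - q)"
  shows "(\<Sum>p<n. of_real (cos_wave n k (int p)) * (a (nat \<bar>int p - int q\<bar>) + h p))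
    = of_real (cos_wave n k (int q)) * (\<Sum>l<n. M_mat n $$ (k, l) * a l)"
proof -
  define u where "u p = complex_of_real (cos_wave n k p)" for p
  have T: "(\<Sum>p<n. u (int p) * a (nat \<bar>int p - int q\<bar>))
    = (\<Sum>p<q. u (int p) * a (q - p)) + u (int q) * a 0 + (\<Sum>p\<in>{Suc q..<n}. u (int p) * a (p - q))"
  proof -
    have "{..<n} = {..<q} \<union> ({q} \<union> {Suc q..<n})" using q by auto
    then have "(\<Sum>p<n. u (int p) * a (nat \<bar>int p - int q\<bar>))
      = (\<Sum>p\<in>{..<q} \<union> ({q} \<union> {Suc q..<n}). u (int p) * a (nat \<bar>int p - int q\<bar>))" by simp
    also have "\<dots> = (\<Sum>p<q. u (int p) * a (nat \<bar>int p - int q\<bar>))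
      + (u (int q) * a 0 + (\<Sum>p\<in>{Suc q..<n}. u (int p) * a (nat \<bar>int p - int q\<bar>)))"
      by (subst sum.union_disjoint, simp, simp, force, subst sum.union_disjoint) auto
    also have "(\<Sum>p<q. u (int p) * a (nat \<bar>int p - int q\<bar>)) = (\<Sum>p<q. u (int p) * a (q - p))"
      by (intro sum.cong) (auto simp: nat_diff_distrib intro!: arg_cong[of _ _ a])
    also have "(\<Sum>p\<in>{Suc q..<n}. u (int p) * a (nat \<bar>int p - int q\<bar>))
      = (\<Sum>p\<in>{Suc q..<n}. u (int p) * a (p - q))"
      by (intro sum.cong) (auto simp: nat_diff_distrib intro!: arg_cong[of _ _ a])
    finally show ?thesis by (simp add: add.assoc)
  qed
  have H: "(\<Sum>p<n. u (int p) * h p) = (\<Sum>p<n - Suc q. u (int p) * a (p + q + 1))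
    + (\<Sum>p\<in>{n - q..<n}. u (int p) * a (2 * n - 1 - p - q))"
  proof -
    have "{..<n} = {..<n - Suc q} \<union> ({n - Suc q} \<union> {n - q..<n})" using q by auto
    then have "(\<Sum>p<n. u (int p) * h p)
      = (\<Sum>p\<in>{..<n - Suc q} \<union> ({n - Suc q} \<union> {n - q..<n}). u (int p) * h p)" by simp
    also have "\<dots> = (\<Sum>p<n - Suc q. u (int p) * h p)
      + (u (int (n - Suc q)) * h (n - Suc q) + (\<Sum>p\<in>{n - q..<n}. u (int p) * h p))"
      by (subst sum.union_disjoint, simp, simp, force, subst sum.union_disjoint) (use q in auto)
    also have "h (n - Suc q) = 0" using q by (simp add: h_def)
    also have "(\<Sum>p<n - Suc q. u (int p) * h p) = (\<Sum>p<n - Suc q. u (int p) * a (p + q + 1))"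
      by (intro sum.cong) (auto simp: h_def)
    also have "(\<Sum>p\<in>{n - q..<n}. u (int p) * h p)
      = (\<Sum>p\<in>{n - q..<n}. u (int p) * a (2 * n - 1 - p - q))"
      by (intro sum.cong) (auto simp: h_def)
    finally show ?thesis by simp
  qed
  have shift: "u (int q) * M_mat n $$ (k, l)
    = u (int q + int l) + u (int q - int l)" if "l \<in> {1..<n}" for l
    using cos_wave_shift[of l k n "int q"] that k unfolding u_def
    by (simp add: M_mat_index mult.commute flip: of_real_add of_real_mult)
  have "{..<n} = insert 0 {1..<n}" using q by auto
  then have "u (int q) * (\<Sum>l<n. M_mat n $$ (k, l) * a l)
    = u (int q) * a 0 + (\<Sum>l\<in>{1..<n}. u (int q) * M_mat n $$ (k, l) * a l)"
    using k by (simp add: M_mat_index[of k n 0] distrib_left sum_distrib_left mult.assoc)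
  also have "(\<Sum>l\<in>{1..<n}. u (int q) * M_mat n $$ (k, l) * a l)
     = (\<Sum>l\<in>{1..<n}. u (int q + int l) * a l) + (\<Sum>l\<in>{1..<n}. u (int q - int l) * a l)"
    by (simp add: shift distrib_right sum.distrib)
  also have "(\<Sum>l\<in>{1..<n}. u (int q + int l) * a l)
    = (\<Sum>l\<in>{1..<n - q}. u (int q + int l) * a l) + (\<Sum>l\<in>{n - q..<n}. u (int q + int l) * a l)"
    using q by (intro sum.atLeastLessThan_concat[symmetric]) auto
  also have "(\<Sum>l\<in>{1..<n - q}. u (int q + int l) * a l) = (\<Sum>p\<in>{Suc q..<n}. u (int p) * a (p - q))"
    by (rule sum.reindex_bij_witness[of _ "\<lambda>p. p - q" "\<lambda>l. l + q"]) (auto simp: algebra_simps)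
  \<comment> \<open>Reflection at the right border.\<close>
  also have "(\<Sum>l\<in>{n - q..<n}. u (int q + int l) * a l)
     = (\<Sum>p\<in>{n - q..<n}. u (int p) * a (2 * n - 1 - p - q))"
  proof (rule sum.reindex_bij_witness[of _ "\<lambda>p. 2 * n - 1 - p - q" "\<lambda>l. 2 * n - 1 - l - q"])
    fix l assume l: "l \<in> {n - q..<n}"
    then have "int (2 * n - 1 - l - q) = 2 * int n - 1 - (int q + int l)" using q by auto
    then have "u (int (2 * n - 1 - l - q)) = u (int q + int l)"
      using cos_wave_reflect_end[of n k "int q + int l"] q by (simp only: u_def)
    moreover have "2 * n - 1 - (2 * n - 1 - l - q) - q = l" using l q by auto
    ultimately show "u (int (2 * n - 1 - l - q)) * a (2 * n - 1 - (2 * n - 1 - l - q) - q)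
       = u (int q + int l) * a l" by (simp only:)
  qed (use q in auto)
  also have "(\<Sum>l\<in>{1..<n}. u (int q - int l) * a l)
    = (\<Sum>l\<in>{1..<Suc q}. u (int q - int l) * a l) + (\<Sum>l\<in>{Suc q..<n}. u (int q - int l) * a l)"
    using q by (intro sum.atLeastLessThan_concat[symmetric]) auto
  also have "(\<Sum>l\<in>{1..<Suc q}. u (int q - int l) * a l) = (\<Sum>p<q. u (int p) * a (q - p))"
    by (rule sum.reindex_bij_witness[of _ "\<lambda>p. q - p" "\<lambda>l. q - l"]) (auto simp: of_nat_diff)
  \<comment> \<open>Reflection at the left border.\<close>
  also have "(\<Sum>l\<in>{Suc q..<n}. u (int q - int l) * a l) = (\<Sum>p<n - Suc q. u (int p) * a (p + q + 1))"
  proof (rule sum.reindex_bij_witness[of _ "\<lambda>p. p + q + 1" "\<lambda>l. l - Suc q"])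
    fix l assume l: "l \<in> {Suc q..<n}"
    then have "int (l - Suc q) = - 1 - (int q - int l)" by auto
    then show "u (int (l - Suc q)) * a (l - Suc q + q + 1) = u (int q - int l) * a l"
      using cos_wave_reflect[of n k "int q - int l"] l by (simp add: u_def)
  qed auto
  finally show ?thesis
    using T H by (simp add: u_def[symmetric] distrib_left sum.distrib algebra_simps)
qed

section \<open>Tensors and their transformed slices\<close>

lemma tensors_nth: "A \<in> tensors m n l \<Longrightarrow> i < l \<Longrightarrow> A ! i \<in> carrier_mat m n"
  by (auto simp: tensors_def)

lemma tensors_length: "A \<in> tensors m n l \<Longrightarrow> length A = l"
  by (simp add: tensors_def)

lemma tensors_dims:
  assumes "A \<in> tensors m n l" "0 < l"
  shows "trows A = m" "tcols A = n"
  using tensors_nth[OF assms] assms by (auto simp: trows_def tcols_def tensors_def hd_conv_nth)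

lemma tensors_eqI:
  assumes "A \<in> tensors m n l" "B \<in> tensors m n l"
    and "\<And>k i j. k < l \<Longrightarrow> i < m \<Longrightarrow> j < n \<Longrightarrow> A ! k $$ (i, j) = B ! k $$ (i, j)"
  shows "A = B"
proof (rule nth_equalityI)
  fix k assume "k < length A"
  then have k: "k < l" using assms(1) by (simp add: tensors_def)
  show "A ! k = B ! k"
    using tensors_nth[OF assms(1) k] tensors_nth[OF assms(2) k] assms(3)[OF k]
    by (intro eq_matI) auto
qed (use assms in \<open>simp add: tensors_def\<close>)

text \<open>
  The mode-3 product of a tensor with a matrix. The dimensions are parameters, so that no property
  of the argument enters and the result always has slices of the same size.
\<close>

definition mode3_mult :: "complex mat \<Rightarrow> nat \<Rightarrow> nat \<Rightarrow> nat \<Rightarrow> tensor \<Rightarrow> tensor" where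
  "mode3_mult N m n l A =
     map (\<lambda>k. mat m n (\<lambda>(i, j). \<Sum>p<l. N $$ (k, p) * A ! p $$ (i, j))) [0..<l]"

lemma mode3_mult_carrier: "mode3_mult N m n l A \<in> tensors m n l"
  by (auto simp: mode3_mult_def tensors_def)

lemma mode3_mult_index:
  "k < l \<Longrightarrow> i < m \<Longrightarrow> j < n \<Longrightarrow>
    mode3_mult N m n l A ! k $$ (i, j) = (\<Sum>p<l. N $$ (k, p) * A ! p $$ (i, j))"
  by (simp add: mode3_mult_def)

lemma mode3_mult_inverse:
  assumes A: "A \<in> tensors m n l" and N: "N \<in> carrier_mat l l" "N' \<in> carrier_mat l l"
    and inv: "N' * N = 1\<^sub>m l"
  shows "mode3_mult N' m n l (mode3_mult N m n l A) = A"
proof (rule tensors_eqI[OF mode3_mult_carrier A])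
  fix k i j assume k: "k < l" and i: "i < m" and j: "j < n"
  have "mode3_mult N' m n l (mode3_mult N m n l A) ! k $$ (i, j)
    = (\<Sum>p<l. \<Sum>q<l. N' $$ (k, p) * N $$ (p, q) * A ! q $$ (i, j))"
    using k i j by (simp add: mode3_mult_index sum_distrib_left mult.assoc)
  also have "\<dots> = (\<Sum>q<l. (\<Sum>p<l. N' $$ (k, p) * N $$ (p, q)) * A ! q $$ (i, j))"
    by (subst sum.swap) (simp add: sum_distrib_right)
  also have "\<dots> = (\<Sum>q<l. (N' * N) $$ (k, q) * A ! q $$ (i, j))"
    using N k by (intro sum.cong) (auto simp: scalar_prod_def atLeast0LessThan)
  also have "\<dots> = (\<Sum>q<l. if q = k then A ! k $$ (i, j) else 0)"
    using k by (intro sum.cong) (auto simp: inv)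
  finally show "mode3_mult N' m n l (mode3_mult N m n l A) ! k $$ (i, j) = A ! k $$ (i, j)"
    using k by simp
qed

lemma L_trans_eq_mode3_mult:
  assumes "A \<in> tensors m n l" "0 < l"
  shows "L_trans A = mode3_mult (M_mat l) m n l A"
  unfolding L_trans_def mode3_mult_def tensors_dims[OF assms] tensors_length[OF assms(1)] ..

lemma L_trans_carrier: "A \<in> tensors m n l \<Longrightarrow> 0 < l \<Longrightarrow> L_trans A \<in> tensors m n l"
  using mode3_mult_carrier by (simp add: L_trans_eq_mode3_mult)

lemma L_trans_nth: "A \<in> tensors m n l \<Longrightarrow> i < l \<Longrightarrow> L_trans A ! i \<in> carrier_mat m n"
  using tensors_nth[OF L_trans_carrier, of A m n l i] by simp

lemma L_trans_bij:
  assumes "0 < l"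
  shows "bij_betw L_trans (tensors m n l) (tensors m n l)"
proof -
  have "M_mat l \<in> Units (ring_mat TYPE(complex) l ())"
    by (rule det_non_zero_imp_unit[OF M_mat_carrier det_M_mat])
  then obtain N where N: "N \<in> carrier_mat l l" "N * M_mat l = 1\<^sub>m l" "M_mat l * N = 1\<^sub>m l"
    by (auto simp: Units_def ring_mat_def)
  show ?thesis
  proof (rule bij_betw_byWitness[where f' = "mode3_mult N m n l"])
    show "\<forall>A\<in>tensors m n l. mode3_mult N m n l (L_trans A) = A"
      using mode3_mult_inverse[OF _ M_mat_carrier N(1,2)] assms by (simp add: L_trans_eq_mode3_mult)
    show "\<forall>A\<in>tensors m n l. L_trans (mode3_mult N m n l A) = A"
      using mode3_mult_inverse[OF _ N(1) M_mat_carrier N(3)] assms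
      by (simp add: L_trans_eq_mode3_mult[OF mode3_mult_carrier])
    show "L_trans ` tensors m n l \<subseteq> tensors m n l" using L_trans_carrier assms by auto
    show "mode3_mult N m n l ` tensors m n l \<subseteq> tensors m n l" using mode3_mult_carrier by auto
  qed
qed

lemma tensor_eq_of_slices:
  assumes "A \<in> tensors m n l" "B \<in> tensors m n l" "0 < l"
    and "\<And>i. i < l \<Longrightarrow> L_trans A ! i = L_trans B ! i"
  shows "A = B"
proof -
  have "L_trans A = L_trans B"
    using assms L_trans_carrier[OF assms(1,3)] L_trans_carrier[OF assms(2,3)]
    by (intro nth_equalityI) (auto simp: tensors_length)
  then show ?thesis using L_trans_bij[OF assms(3), of m n] assms(1,2)
    by (auto simp: bij_betw_def dest: inj_onD)
qed

text \<open>
  This justifies the definite descriptions that define the C-product and the identity tensor.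
\<close>

lemma ex1_tensor_slices:
  assumes l: "0 < l" and S: "\<And>i. i < l \<Longrightarrow> S i \<in> carrier_mat m n"
  shows "\<exists>!A. A \<in> tensors m n l \<and> (\<forall>i<l. L_trans A ! i = S i)"
proof (rule ex_ex1I)
  have "map S [0..<l] \<in> tensors m n l" using S by (auto simp: tensors_def)
  then have "map S [0..<l] \<in> L_trans ` tensors m n l"
    using L_trans_bij[OF l] by (simp add: bij_betw_def)
  then obtain A where "A \<in> tensors m n l" "map S [0..<l] = L_trans A" by blast
  then show "\<exists>A. A \<in> tensors m n l \<and> (\<forall>i<l. L_trans A ! i = S i)"
    by (intro exI[of _ A]) (auto simp: \<open>map S [0..<l] = L_trans A\<close>[symmetric])
qed (use tensor_eq_of_slices[OF _ _ l] in auto)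

lemma cprod_slices:
  assumes A: "A \<in> tensors m n l" and B: "B \<in> tensors n p l" and l: "0 < l"
  shows "A *\<^sub>c B \<in> tensors m p l"
    and "i < l \<Longrightarrow> L_trans (A *\<^sub>c B) ! i = L_trans A ! i * L_trans B ! i"
proof -
  have "\<exists>!C. C \<in> tensors m p l \<and> (\<forall>i<l. L_trans C ! i = L_trans A ! i * L_trans B ! i)"
    using L_trans_nth[OF A] L_trans_nth[OF B] by (intro ex1_tensor_slices[OF l] mult_carrier_mat) auto
  from theI'[OF this]
  have *: "A *\<^sub>c B \<in> tensors m p l \<and> (\<forall>i<l. L_trans (A *\<^sub>c B) ! i = L_trans A ! i * L_trans B ! i)"
    unfolding cprod_def tensors_dims(1)[OF A l] tensors_dims(2)[OF B l] tensors_length[OF A] .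
  then show "A *\<^sub>c B \<in> tensors m p l"
    and "i < l \<Longrightarrow> L_trans (A *\<^sub>c B) ! i = L_trans A ! i * L_trans B ! i" by blast+
qed

lemma tident_slices:
  assumes "0 < l"
  shows "tident n l \<in> tensors n n l" and "i < l \<Longrightarrow> L_trans (tident n l) ! i = 1\<^sub>m n"
proof -
  have "\<exists>!E. E \<in> tensors n n l \<and> (\<forall>i<l. L_trans E ! i = 1\<^sub>m n)"
    by (intro ex1_tensor_slices[OF assms]) auto
  from theI'[OF this]
  have "tident n l \<in> tensors n n l \<and> (\<forall>i<l. L_trans (tident n l) ! i = 1\<^sub>m n)"
    unfolding tident_def .
  then show "tident n l \<in> tensors n n l" and "i < l \<Longrightarrow> L_trans (tident n l) ! i = 1\<^sub>m n" by blast+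
qed

text \<open>
  Square tensors as a monoid in the sense of the algebra library, which supplies the uniqueness of
  inverses and gives access to the uniqueness of Drazin inverses proved above.
\<close>

definition tensor_monoid :: "nat \<Rightarrow> nat \<Rightarrow> tensor monoid" where
  "tensor_monoid n l = \<lparr>carrier = tensors n n l, mult = cprod, one = tident n l\<rparr>"

lemma tensor_monoid_simps [simp]:
  "carrier (tensor_monoid n l) = tensors n n l"
  "mult (tensor_monoid n l) = cprod"
  "one (tensor_monoid n l) = tident n l"
  by (simp_all add: tensor_monoid_def)

lemma tensor_monoid:
  assumes l: "0 < l"
  shows "monoid (tensor_monoid n l)"
proof (rule monoidI; unfold tensor_monoid_simps)
  fix A B C assume A: "A \<in> tensors n n l" and B: "B \<in> tensors n n l" and C: "C \<in> tensors n n l"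
  note [simp] = cprod_slices[of _ n n l _ n, OF _ _ l]
  show "A *\<^sub>c B \<in> tensors n n l" using A B by simp
  show "A *\<^sub>c B *\<^sub>c C = A *\<^sub>c (B *\<^sub>c C)"
    using A B C L_trans_nth[OF A] L_trans_nth[OF B] L_trans_nth[OF C]
    by (intro tensor_eq_of_slices[OF _ _ l, of _ n n])
      (auto intro!: assoc_mult_mat[of _ n n _ n _ n])
  show "tident n l *\<^sub>c A = A" "A *\<^sub>c tident n l = A"
    using A tident_slices[OF l] left_mult_one_mat[OF L_trans_nth[OF A]]
      right_mult_one_mat[OF L_trans_nth[OF A]]
    by (auto intro!: tensor_eq_of_slices[OF _ _ l, of _ n n])
qed (rule tident_slices(1)[OF l])

lemma tpow_eq_monoid_pow:
  assumes "A \<in> tensors n n l" "0 < l"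
  shows "tpow A k = A [^]\<^bsub>tensor_monoid n l\<^esub> k"
  using assms by (induction k) (simp_all add: tensors_dims tensors_length nat_pow_def)

lemma tpow_slices:
  assumes A: "A \<in> tensors n n l" and l: "0 < l"
  shows "tpow A k \<in> tensors n n l"
    and "i < l \<Longrightarrow> L_trans (tpow A k) ! i = (L_trans A ! i) ^\<^sub>m k"
proof -
  have "tpow A k \<in> tensors n n l \<and> (\<forall>i<l. L_trans (tpow A k) ! i = (L_trans A ! i) ^\<^sub>m k)"
  proof (induction k)
    case 0
    then show ?case
      using tident_slices[OF l, where n = n] L_trans_nth[OF A] A l
      by (auto simp: tensors_dims tensors_length)
  next
    case (Suc k)
    then show ?case using cprod_slices[OF conjunct1[OF Suc] A l] by simp
  qed
  then show "tpow A k \<in> tensors n n l"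
    and "i < l \<Longrightarrow> L_trans (tpow A k) ! i = (L_trans A ! i) ^\<^sub>m k" by blast+
qed

lemma tinverse_eqI:
  assumes l: "0 < l" and X: "is_tinverse n l B X"
  shows "tinverse B = X"
proof -
  interpret monoid "tensor_monoid n l" by (rule tensor_monoid[OF l])
  have B: "B \<in> tensors n n l" using X by (simp add: is_tinverse_def)
  have "Y = X" if "is_tinverse n l B Y" for Y
    using inv_unique[of Y B X] X that by (simp add: is_tinverse_def)
  with X have "(THE Y. is_tinverse n l B Y) = X" by (intro the_equality)
  then show ?thesis by (simp add: tinverse_def tensors_dims[OF B l] tensors_length[OF B])
qed

lemma is_tinverse_iff_slices:
  assumes l: "0 < l" and B: "B \<in> tensors n n l" and X: "X \<in> tensors n n l"
  shows "is_tinverse n l B X \<longleftrightarrow>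
    (\<forall>i<l. L_trans B ! i * L_trans X ! i = 1\<^sub>m n \<and> L_trans X ! i * L_trans B ! i = 1\<^sub>m n)"
    (is "_ \<longleftrightarrow> ?R")
proof
  assume "is_tinverse n l B X"
  then show ?R using cprod_slices(2)[OF B X l] cprod_slices(2)[OF X B l] tident_slices[OF l]
    by (metis is_tinverse_def)
next
  assume R: ?R
  have "B *\<^sub>c X = tident n l" "X *\<^sub>c B = tident n l"
    using R cprod_slices[OF B X l] cprod_slices[OF X B l] tident_slices[OF l, where n = n]
    by (auto intro!: tensor_eq_of_slices[OF _ _ l, of _ n n])
  with B X show "is_tinverse n l B X" by (simp add: is_tinverse_def)
qed

section \<open>The block Toeplitz-plus-Hankel matrix and the index\<close>

text \<open>
  The Kronecker product of the \<open>k\<close>-th cosine wave, as a row vector, with the identity matrix.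
\<close>

definition cos_block_row :: "nat \<Rightarrow> nat \<Rightarrow> nat \<Rightarrow> complex mat" where
  "cos_block_row n l k = mat n (n * l)
     (\<lambda>(i, b). if b mod n = i then complex_of_real (cos_wave l k (int (b div n))) else 0)"

lemma cos_block_row_carrier: "cos_block_row n l k \<in> carrier_mat n (n * l)"
  by (simp add: cos_block_row_def)

lemma tmat_carrier:
  assumes "A \<in> tensors n n l" "0 < l"
  shows "tmat A \<in> carrier_mat (n * l) (n * l)"
  using tensors_dims[OF assms] tensors_length[OF assms(1)] by (simp add: tmat_def Let_def)

text \<open>
  The block version of \<open>toeplitz_hankel_cos_wave\<close>, obtained from it entry by entry: the rows of
  the block row span a left invariant subspace of the block matrix, on which it acts as the \<open>k\<close>-th
  transformed slice.
\<close>

lemma cos_block_row_tmat: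
  assumes A: "A \<in> tensors n n l" and n: "0 < n" and k: "k < l"
  shows "cos_block_row n l k * tmat A = L_trans A ! k * cos_block_row n l k"
proof (rule eq_matI)
  have l: "0 < l" using k by simp
  let ?V = "cos_block_row n l k"
  note V = carrier_matD[OF cos_block_row_carrier[of n l k]]
  note T = carrier_matD[OF tmat_carrier[OF A l]]
  note La = carrier_matD[OF L_trans_nth[OF A k]]
  show "dim_row (?V * tmat A) = dim_row (L_trans A ! k * ?V)" by (simp add: V La)
  show "dim_col (?V * tmat A) = dim_col (L_trans A ! k * ?V)" by (simp add: V T)
  fix i b assume "i < dim_row (L_trans A ! k * ?V)" "b < dim_col (L_trans A ! k * ?V)"
  then have i: "i < n" and b: "b < n * l" by (simp_all add: V La)
  define q j where "q = b div n" and "j = b mod n"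
  have q: "q < l" using b by (simp add: q_def less_mult_imp_div_less mult.commute)
  have j: "j < n" using n by (simp add: j_def)
  have idx: "p * n + i < n * l" if "p < l" for p
  proof -
    have "p * n + i < Suc p * n" using i by simp
    also have "\<dots> \<le> l * n" using that by (intro mult_le_mono1) simp
    finally show ?thesis by (simp add: mult.commute)
  qed
  let ?a = "\<lambda>p. A ! p $$ (i, j)"
  have "(?V * tmat A) $$ (i, b) = (\<Sum>a<n * l. ?V $$ (i, a) * tmat A $$ (a, b))"
    using i b by (simp add: scalar_prod_def atLeast0LessThan V T)
  also have "\<dots> = (\<Sum>a\<in>(\<lambda>p. p * n + i) ` {..<l}. ?V $$ (i, a) * tmat A $$ (a, b))"
  proof (rule sum.mono_neutral_right)
    show "(\<lambda>p. p * n + i) ` {..<l} \<subseteq> {..<n * l}" using idx by auto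
    show "\<forall>a\<in>{..<n * l} - (\<lambda>p. p * n + i) ` {..<l}. ?V $$ (i, a) * tmat A $$ (a, b) = 0"
    proof
      fix a assume a: "a \<in> {..<n * l} - (\<lambda>p. p * n + i) ` {..<l}"
      have "a mod n \<noteq> i"
      proof
        assume "a mod n = i"
        then have "a = a div n * n + i" by (metis div_mult_mod_eq)
        moreover have "a div n < l" using a by (simp add: less_mult_imp_div_less mult.commute)
        ultimately show False using a by blast
      qed
      then show "?V $$ (i, a) * tmat A $$ (a, b) = 0" using a i by (simp add: cos_block_row_def)
    qed
  qed simp
  also have "\<dots> = (\<Sum>p<l. ?V $$ (i, p * n + i) * tmat A $$ (p * n + i, b))"
    using n by (subst sum.reindex) (auto simp: inj_on_def)
  also have "\<dots> = (\<Sum>p<l. of_real (cos_wave l k (int p)) * (?a (nat \<bar>int p - int q\<bar>) +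
      (if p + q + 1 < l then ?a (p + q + 1) else if p + q + 1 = l then 0
       else ?a (2 * l - 1 - p - q))))"
  proof (intro sum.cong refl)
    fix p assume "p \<in> {..<l}"
    then have p: "p < l" by simp
    have "?V $$ (i, p * n + i) = of_real (cos_wave l k (int p))"
      using i idx[OF p] n by (simp add: cos_block_row_def)
    moreover have "tmat A $$ (p * n + i, b) = th_block A p q $$ (i, j)"
      using i idx[OF p] b n tensors_dims[OF A l] tensors_length[OF A]
      by (simp add: tmat_def Let_def q_def j_def)
    moreover have "th_block A p q $$ (i, j) = ?a (nat \<bar>int p - int q\<bar>) + hankel_block A p q $$ (i, j)"
    proof -
      have "nat \<bar>int p - int q\<bar> < l" using p q by auto
      note carrier_matD[OF tensors_nth[OF A this]]
      moreover have "hankel_block A p q \<in> carrier_mat n n"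
        using tensors_nth[OF A] p q tensors_dims[OF A l] tensors_length[OF A]
        by (auto simp: hankel_block_def Let_def)
      ultimately show ?thesis using i j by (simp add: th_block_def)
    qed
    moreover have "hankel_block A p q $$ (i, j) =
      (if p + q + 1 < l then ?a (p + q + 1) else if p + q + 1 = l then 0 else ?a (2 * l - 1 - p - q))"
      using i j tensors_dims[OF A l] tensors_length[OF A] by (simp add: hankel_block_def Let_def)
    ultimately show "?V $$ (i, p * n + i) * tmat A $$ (p * n + i, b)
      = of_real (cos_wave l k (int p)) * (?a (nat \<bar>int p - int q\<bar>) +
      (if p + q + 1 < l then ?a (p + q + 1) else if p + q + 1 = l then 0
       else ?a (2 * l - 1 - p - q)))" by simp
  qed
  also have "\<dots> = of_real (cos_wave l k (int q)) * (\<Sum>p<l. M_mat l $$ (k, p) * ?a p)"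
    by (rule toeplitz_hankel_cos_wave[OF k q, of ?a])
  also have "(\<Sum>p<l. M_mat l $$ (k, p) * ?a p) = L_trans A ! k $$ (i, j)"
    using i j k by (simp add: L_trans_eq_mode3_mult[OF A l] mode3_mult_index)
  also have "of_real (cos_wave l k (int q)) * L_trans A ! k $$ (i, j)
     = (\<Sum>i'<n. if i' = j then L_trans A ! k $$ (i, j) * of_real (cos_wave l k (int q)) else 0)"
    using j by simp
  also have "\<dots> = (\<Sum>i'<n. L_trans A ! k $$ (i, i') * ?V $$ (i', b))"
    using b by (intro sum.cong) (auto simp: cos_block_row_def q_def j_def)
  also have "\<dots> = (L_trans A ! k * ?V) $$ (i, b)"
    using i b by (simp add: scalar_prod_def atLeast0LessThan V La)
  finally show "(?V * tmat A) $$ (i, b) = (L_trans A ! k * ?V) $$ (i, b)" .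
qed

text \<open>
  Already the first block, a nonzero multiple of the identity, is invertible.
\<close>

lemma cos_block_row_right_inverse:
  assumes n: "0 < n" and k: "k < l"
  shows "\<exists>U \<in> carrier_mat (n * l) n. cos_block_row n l k * U = 1\<^sub>m n"
proof -
  define U where "U = mat (n * l) n (\<lambda>(a, j). if a = j then 1 / complex_of_real (cos_wave l k 0) else 0)"
  have le: "n \<le> n * l" using k by simp
  have "cos_block_row n l k * U = 1\<^sub>m n"
  proof (rule eq_matI)
    fix i j assume "i < dim_row (1\<^sub>m n :: complex mat)" "j < dim_col (1\<^sub>m n :: complex mat)"
    then have i: "i < n" and j: "j < n" by simp_all
    have jl: "j < n * l" by (rule less_le_trans[OF j le])
    have "(cos_block_row n l k * U) $$ (i, j) = (\<Sum>a<n * l. cos_block_row n l k $$ (i, a) * U $$ (a, j))"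
      using i j carrier_matD[OF cos_block_row_carrier[of n l k]]
      by (simp add: scalar_prod_def atLeast0LessThan U_def)
    also have "\<dots> = (\<Sum>a<n * l. if a = j then cos_block_row n l k $$ (i, j) / of_real (cos_wave l k 0) else 0)"
      using j by (intro sum.cong) (auto simp: U_def)
    also have "\<dots> = cos_block_row n l k $$ (i, j) / of_real (cos_wave l k 0)" using jl by simp
    also have "\<dots> = 1\<^sub>m n $$ (i, j)"
      using i j jl cos_wave_0_pos[OF k] by (auto simp: cos_block_row_def)
    finally show "(cos_block_row n l k * U) $$ (i, j) = 1\<^sub>m n $$ (i, j)" .
  qed (simp_all add: U_def cos_block_row_def)
  moreover have "U \<in> carrier_mat (n * l) n" by (simp add: U_def)
  ultimately show ?thesis by blast
qed

lemma intertwine_pow_mat: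
  fixes V :: "'a :: semiring_1 mat"
  assumes V: "V \<in> carrier_mat n m" and T: "T \<in> carrier_mat m m" and a: "a \<in> carrier_mat n n"
    and eq: "V * T = a * V"
  shows "V * T ^\<^sub>m k = a ^\<^sub>m k * V"
proof (induction k)
  case 0
  show ?case using V T a by simp
next
  case (Suc k)
  note dims = carrier_matD[OF V] carrier_matD[OF T] carrier_matD[OF a]
  have "V * T ^\<^sub>m Suc k = (V * T ^\<^sub>m k) * T"
    by (simp add: dims assoc_mult_mat_dim del: assoc_mult_mat)
  also have "\<dots> = a ^\<^sub>m k * (V * T)"
    unfolding Suc by (simp add: dims assoc_mult_mat_dim del: assoc_mult_mat)
  also have "\<dots> = a ^\<^sub>m Suc k * V"
    unfolding eq by (simp add: dims assoc_mult_mat_dim del: assoc_mult_mat)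
  finally show ?case .
qed

text \<open>
  Ranks of powers decrease, so two consecutive ones agree somewhere and the least such exponent
  exists.
\<close>

lemma mindex_rank_eq:
  fixes T :: "complex mat"
  assumes T: "T \<in> carrier_mat n n"
  shows "mrank (T ^\<^sub>m mindex T) = mrank (T ^\<^sub>m Suc (mindex T))"
proof -
  let ?f = "\<lambda>k. mrank (T ^\<^sub>m k)"
  have dec: "?f (Suc k) \<le> ?f k" for k
    using vec_space.rank_mult_le[of "T ^\<^sub>m k" n n T n] T by (simp add: mrank_def)
  have "\<exists>k. ?f k = ?f (k + 1)"
  proof (rule ccontr)
    assume "\<nexists>k. ?f k = ?f (k + 1)"
    then have less: "?f (Suc k) < ?f k" for k using dec[of k] by (metis Suc_eq_plus1 le_neq_implies_less)
    have "?f k + k \<le> ?f 0" for k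
    proof (induction k)
      case (Suc k)
      then show ?case using less[of k] by simp
    qed simp
    from this[of "Suc (?f 0)"] show False by simp
  qed
  from LeastI_ex[OF this] show ?thesis by (simp add: mindex_def)
qed

text \<open>
  The index of the tensor is defined through the block matrix \<open>T\<close>, whereas the Drazin equations are
  solved slice by slice. Equality of ranks gives \<open>T ^ k = T ^ (k + 1) * Y\<close>; multiplying by a block
  row on the left and by its right inverse on the right transports this equation to the slice.
\<close>

lemma slice_factor_at_tindex:
  assumes A: "A \<in> tensors n n l" and n: "0 < n" and i: "i < l"
  shows "\<exists>y \<in> carrier_mat n n.
    (L_trans A ! i) ^\<^sub>m tindex A = (L_trans A ! i) ^\<^sub>m Suc (tindex A) * y"
proof -
  have l: "0 < l" using i by simp
  let ?T = "tmat A" and ?a = "L_trans A ! i" and ?V = "cos_block_row n l i" and ?k = "tindex A"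
  note T = tmat_carrier[OF A l] and a = L_trans_nth[OF A i] and V = cos_block_row_carrier[of n l i]
  have "vec_space.rank (n * l) (?T ^\<^sub>m ?k * ?T) = vec_space.rank (n * l) (?T ^\<^sub>m ?k)"
    using mindex_rank_eq[OF T] T by (simp add: tindex_def mrank_def)
  from vec_space.rank_mult_eq_imp_factor[OF pow_carrier_mat[OF T] T this]
  obtain Y where Y: "Y \<in> carrier_mat (n * l) (n * l)" "?T ^\<^sub>m ?k = ?T ^\<^sub>m Suc ?k * Y" by auto
  obtain U where U: "U \<in> carrier_mat (n * l) n" "?V * U = 1\<^sub>m n"
    using cos_block_row_right_inverse[OF n i] by blast
  note dims = carrier_matD[OF V] carrier_matD[OF T] carrier_matD[OF a] carrier_matD[OF Y(1)]
    carrier_matD[OF U(1)]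
  note tw = intertwine_pow_mat[OF V T a cos_block_row_tmat[OF A n i]]
  have "?a ^\<^sub>m ?k = ?a ^\<^sub>m ?k * (?V * U)" using a by (simp add: U(2))
  also have "\<dots> = ?V * ?T ^\<^sub>m ?k * U"
    unfolding tw by (simp add: dims assoc_mult_mat_dim del: assoc_mult_mat)
  also have "\<dots> = (?V * ?T ^\<^sub>m Suc ?k) * Y * U"
    by (subst Y(2)) (simp add: dims assoc_mult_mat_dim del: assoc_mult_mat pow_mat.simps)
  also have "\<dots> = ?a ^\<^sub>m Suc ?k * (?V * Y * U)"
    unfolding tw by (simp add: dims assoc_mult_mat_dim del: assoc_mult_mat pow_mat.simps)
  finally show ?thesis using V Y(1) U(1) by (intro bexI[of _ "?V * Y * U"]) (auto intro!: carrier_matI)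
qed

section \<open>The Drazin inverse from a C-QDR decomposition\<close>

theorem theorem4p2:
  fixes A Q D R :: tensor and n1 n3 r k :: nat
  assumes "0 < n1" and "0 < n3"
    and "A \<in> tensors n1 n1 n3"
    and "tindex A = k"
    and "is_CQDR n1 n1 n3 r (tpow A k) Q D R"
  shows "(\<exists>!X. is_drazin_inverse A X) \<and> tinvertible r n3 (R *\<^sub>c A *\<^sub>c Q) \<and>
    drazin_inverse A = Q *\<^sub>c tinverse (R *\<^sub>c A *\<^sub>c Q) *\<^sub>c R"
proof -
  note n1 = assms(1) and n3 = assms(2) and A = assms(3) and k = assms(4)
  have Q: "Q \<in> tensors n1 r n3" and D: "D \<in> tensors r r n3" and R: "R \<in> tensors r n1 n3"
    and fac: "tpow A k = Q *\<^sub>c D *\<^sub>c R"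
    and rankQ: "\<And>i. i < n3 \<Longrightarrow> mrank (L_trans Q ! i) = r"
    and rankR: "\<And>i. i < n3 \<Longrightarrow> mrank (L_trans R ! i) = r"
    using assms(5) by (auto simp: is_CQDR_def)
  obtain D' where D': "is_tinverse r n3 D D'"
    using assms(5) by (auto simp: is_CQDR_def tinvertible_def)
  then have D'c: "D' \<in> tensors r r n3" by (simp add: is_tinverse_def)
  let ?C = "R *\<^sub>c A *\<^sub>c Q"
  note RA = cprod_slices[OF R A n3]
  note C = cprod_slices[OF RA(1) Q n3]
  let ?a = "\<lambda>i. L_trans A ! i" and ?q = "\<lambda>i. L_trans Q ! i"
    and ?d = "\<lambda>i. L_trans D ! i" and ?\<rho> = "\<lambda>i. L_trans R ! i" and ?d' = "\<lambda>i. L_trans D' ! i"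
  have d': "?d' i * ?d i = 1\<^sub>m r" if "i < n3" for i
    using D' that by (simp add: is_tinverse_iff_slices[OF n3 D D'c])
  have fac_slice: "?a i ^\<^sub>m k = ?q i * ?d i * ?\<rho> i" if i: "i < n3" for i
    using arg_cong[OF fac, of "\<lambda>X. L_trans X ! i"] i tpow_slices(2)[OF A n3 i]
      cprod_slices(2)[OF cprod_slices(1)[OF Q D n3] R n3 i] cprod_slices(2)[OF Q D n3 i] by simp
  have left: "\<exists>q' \<in> carrier_mat r n1. q' * ?q i = 1\<^sub>m r" if i: "i < n3" for i
    using full_column_rank_imp_left_inverse[OF L_trans_nth[OF Q i]] rankQ[OF i] L_trans_nth[OF Q i]
    by (simp add: mrank_def)
  have right: "\<exists>\<rho>' \<in> carrier_mat n1 r. ?\<rho> i * \<rho>' = 1\<^sub>m r" if i: "i < n3" for i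
    using vec_space.full_row_rank_imp_right_inverse[OF L_trans_nth[OF R i]] rankR[OF i]
      L_trans_nth[OF R i]
    by (simp add: mrank_def)
  have inv_slice: "\<exists>s \<in> carrier_mat r r. ?\<rho> i * ?a i * ?q i * s = 1\<^sub>m r" if i: "i < n3" for i
  proof -
    obtain q' where q': "q' \<in> carrier_mat r n1" "q' * ?q i = 1\<^sub>m r" using left[OF i] by blast
    obtain \<rho>' where \<rho>': "\<rho>' \<in> carrier_mat n1 r" "?\<rho> i * \<rho>' = 1\<^sub>m r" using right[OF i] by blast
    obtain y where y: "y \<in> carrier_mat n1 n1" "?a i ^\<^sub>m k = ?a i ^\<^sub>m Suc k * y"
      using slice_factor_at_tindex[OF A n1 i] unfolding k by blast
    show ?thesis
      by (rule full_rank_factorization_core_invertible[OF L_trans_nth[OF A i] L_trans_nth[OF Q i]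
            L_trans_nth[OF D i] L_trans_nth[OF R i] q' \<rho>' L_trans_nth[OF D'c i] d'[OF i]
            fac_slice[OF i] y])
  qed
  then obtain s where s: "\<And>i. i < n3 \<Longrightarrow> s i \<in> carrier_mat r r"
    "\<And>i. i < n3 \<Longrightarrow> ?\<rho> i * ?a i * ?q i * s i = 1\<^sub>m r" by metis
  obtain S where S: "S \<in> tensors r r n3" and S_slice: "\<And>i. i < n3 \<Longrightarrow> L_trans S ! i = s i"
    using ex1_tensor_slices[OF n3, of s r r] s(1) by blast
  have "is_tinverse r n3 ?C S"
    unfolding is_tinverse_iff_slices[OF n3 C(1) S]
  proof (intro allI impI)
    fix i assume i: "i < n3"
    have "L_trans ?C ! i * L_trans S ! i = 1\<^sub>m r"
      using s(2)[OF i] by (simp add: C(2)[OF i] RA(2)[OF i] S_slice[OF i])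
    with mat_mult_left_right_inverse[OF L_trans_nth[OF C(1) i] L_trans_nth[OF S i] this]
    show "L_trans ?C ! i * L_trans S ! i = 1\<^sub>m r \<and> L_trans S ! i * L_trans ?C ! i = 1\<^sub>m r" by simp
  qed
  then have invertible: "tinvertible r n3 ?C" and inverse: "tinverse ?C = S"
    using tinverse_eqI[OF n3] by (auto simp: tinvertible_def)
  \<comment> \<open>Each slice of \<open>X\<close> has the form of the Drazin inverse of a full rank factorization.\<close>
  define X where "X = Q *\<^sub>c S *\<^sub>c R"
  note QS = cprod_slices[OF Q S n3]
  have X: "X \<in> tensors n1 n1 n3" using cprod_slices(1)[OF QS(1) R n3] by (simp add: X_def)
  have X_slice: "L_trans X ! i = ?q i * s i * ?\<rho> i" if i: "i < n3" for i
    using cprod_slices(2)[OF QS(1) R n3 i] QS(2)[OF i] S_slice[OF i] by (simp add: X_def)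
  have drazin_slice: "?a i ^\<^sub>m Suc k * L_trans X ! i = ?a i ^\<^sub>m k"
    "L_trans X ! i * ?a i * L_trans X ! i = L_trans X ! i"
    "?a i * L_trans X ! i = L_trans X ! i * ?a i" if i: "i < n3" for i
  proof -
    obtain q' where q': "q' \<in> carrier_mat r n1" "q' * ?q i = 1\<^sub>m r" using left[OF i] by blast
    obtain \<rho>' where \<rho>': "\<rho>' \<in> carrier_mat n1 r" "?\<rho> i * \<rho>' = 1\<^sub>m r" using right[OF i] by blast
    note full_rank_factorization_drazin[OF L_trans_nth[OF A i] L_trans_nth[OF Q i]
            L_trans_nth[OF D i] L_trans_nth[OF R i] q' \<rho>' L_trans_nth[OF D'c i] d'[OF i]
            fac_slice[OF i] s(1)[OF i] s(2)[OF i]]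
    then show "?a i ^\<^sub>m Suc k * L_trans X ! i = ?a i ^\<^sub>m k"
    "L_trans X ! i * ?a i * L_trans X ! i = L_trans X ! i"
    "?a i * L_trans X ! i = L_trans X ! i * ?a i" unfolding X_slice[OF i] by blast+
  qed
  note AX = cprod_slices[OF A X n3] and XA = cprod_slices[OF X A n3]
  have drazin: "is_drazin_inverse A X"
    unfolding is_drazin_inverse_def tensors_dims(1)[OF A n3] tensors_length[OF A] k
  proof (intro conjI)
    note P = tpow_slices[OF A n3]
    show "tpow A (k + 1) *\<^sub>c X = tpow A k"
      using cprod_slices[OF P(1) X n3] P drazin_slice(1)
      by (intro tensor_eq_of_slices[OF _ _ n3]) (simp_all del: tpow.simps pow_mat.simps)
    show "X *\<^sub>c A *\<^sub>c X = X"
      using cprod_slices[OF XA(1) X n3] XA X drazin_slice(2)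
      by (intro tensor_eq_of_slices[OF _ _ n3]) simp_all
    show "A *\<^sub>c X = X *\<^sub>c A"
      using AX XA drazin_slice(3) by (intro tensor_eq_of_slices[OF _ _ n3]) simp_all
  qed (rule X)
  interpret monoid "tensor_monoid n1 n3" by (rule tensor_monoid[OF n3])
  have unique: "Y = Z" if "is_drazin_inverse A Y" "is_drazin_inverse A Z" for Y Z
    by (rule drazin_inverse_unique[of A Y Z k])
      (use that A n3 k in \<open>simp_all add: is_drazin_inverse_def tensors_dims tensors_length
        tpow_eq_monoid_pow[symmetric] del: nat_pow_Suc\<close>)
  have "\<exists>!X. is_drazin_inverse A X" using drazin unique by blast
  moreover have "drazin_inverse A = X"
    unfolding drazin_inverse_def using drazin unique by blast
  ultimately show ?thesis using invertible by (simp add: inverse X_def)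
qed

end
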